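(* Let $s>\frac52$, let $w_0=(\rho_0,u_0,v_0)\in H^{s-1}(\mathbb{R})\times H^s(\mathbb{R})\times H^s(\mathbb{R})$, let $T=T(w_0)>0$, and let $w=(\rho,u,v)\in C([0,T);H^{s-1}\times H^s\times H^s)$ be the solution, with initial data $w_0$, of $$\begin{cases}\rho_t+(\rho uv)_x=0,\\ m_t+uvm_x+3vu_xm+\rho^2u=0,\\ n_t+uvn_x+3v_xun-\rho^2v=0,\\ m=u-u_{xx},\quad n=v-v_{xx}.\end{cases}$$ If, for $\beta\in(0,\infty)$ and $\gamma\in(\frac{\beta}{3},\beta)$, the initial data satisfy $$\begin{cases}\rho_0(x)\sim o\left((\ln(e+\beta+|x|))^{-\beta}\right),&|x|\to\infty,\\ \rho_{0,x}(x),u_0(x),u_{0,x}(x),u_{0,xx}(x),v_0(x),v_{0,x}(x),v_{0,xx}(x)\sim O\left((\ln(e+\beta+|x|))^{-\gamma}\right),&|x|\to\infty,\end{cases}$$ then $$\rho(t,x)\sim o\left((\ln(e+\beta+|x|))^{-\beta}\right),\quad|x|\to\infty,$$ uniformly for $t$ in the interval $[0,T_0]$ for some $T_0<T$.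
   Context: $T(w_0)$ is the lifespan of the solution. Notation: $f(x)\sim O(g(x))$ as $|x|\to\infty$ means $\limsup_{|x|\to\infty}\frac{|f(x)|}{|g(x)|}\le K$ for some positive constant $K$, and $f(x)\sim o(g(x))$ as $|x|\to\infty$ means $\lim_{|x|\to\infty}\frac{|f(x)|}{|g(x)|}=0$. *)

theory Defs
  imports "HOL-Analysis.Analysis" "HOL-Library.Landau_Symbols"
begin

section \<open>Sobolev spaces on the real line\<close>

definition square_integrable :: "(real \<Rightarrow> 'a::{banach, second_countable_topology}) \<Rightarrow> bool" where
  "square_integrable f \<longleftrightarrow>
     f \<in> borel_measurable lborel \<and> integrable lborel (\<lambda>x. (norm (f x))\<^sup>2)"

definition truncated_fourier :: "(real \<Rightarrow> real) \<Rightarrow> real \<Rightarrow> real \<Rightarrow> complex" where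
  "truncated_fourier f R \<xi> =
     complex_of_real (1 / sqrt (2 * pi)) *
       (LINT x:{-R..R}|lborel. complex_of_real (f x) * cis (- (x * \<xi>)))"

text \<open>
  The Fourier--Plancherel transform: \<open>F\<close> is the limit in \<open>L\<^sup>2\<close> of the truncated Fourier integrals
  of \<open>f\<close>. The transform is determined only up to null sets, hence a relation. The distance is a
  nonnegative integral, so that it is infinite (rather than 0) if the difference is not in \<open>L\<^sup>2\<close>.
\<close>

definition has_fourier_L2 :: "(real \<Rightarrow> real) \<Rightarrow> (real \<Rightarrow> complex) \<Rightarrow> bool" where
  "has_fourier_L2 f F \<longleftrightarrow>
     square_integrable f \<and> square_integrable F \<and>
     ((\<lambda>R. \<integral>\<^sup>+ \<xi>. ennreal ((norm (F \<xi> - truncated_fourier f R \<xi>))\<^sup>2) \<partial>lborel) \<longlongrightarrow> 0) at_top"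

text \<open>
  \<open>H\<^sup>s(\<real>)\<close> for \<open>s \<ge> 0\<close>, as a set of functions containing every representative of each class.
\<close>

definition sobolev :: "real \<Rightarrow> (real \<Rightarrow> real) set" where
  "sobolev s = {f. \<exists>F. has_fourier_L2 f F \<and>
     integrable lborel (\<lambda>\<xi>. (1 + \<xi>\<^sup>2) powr s * (norm (F \<xi>))\<^sup>2)}"

text \<open>The value does not depend on the choice of \<open>F\<close>; it is only meaningful on \<^term>\<open>sobolev s\<close>.\<close>

definition sobolev_norm :: "real \<Rightarrow> (real \<Rightarrow> real) \<Rightarrow> real" where
  "sobolev_norm s f =
     (let F = (SOME F. has_fourier_L2 f F)
      in sqrt (LINT \<xi>|lborel. (1 + \<xi>\<^sup>2) powr s * (norm (F \<xi>))\<^sup>2))"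

text \<open>
  For \<open>s > 1/2\<close> every class in \<open>H\<^sup>s(\<real>)\<close> has exactly one continuous representative, and pointwise
  values and derivatives refer to it. It is of class \<open>C\<^sup>1\<close> for \<open>s > 3/2\<close> and \<open>C\<^sup>2\<close> for
  \<open>s > 5/2\<close>, so that \<^const>\<open>deriv\<close> can be used below.
\<close>

definition sobolev_cont :: "real \<Rightarrow> (real \<Rightarrow> real) set" where
  "sobolev_cont s = {f \<in> sobolev s. continuous_on UNIV f}"

text \<open>
  \<open>C([0,T); H\<^sup>s(\<real>))\<close>; the end point may be infinite. Values at times outside \<open>[0,T)\<close> are
  irrelevant.
\<close>

definition time_interval :: "ereal \<Rightarrow> real set" where
  "time_interval T = {t. 0 \<le> t \<and> ereal t < T}"

definition sobolev_curve :: "real \<Rightarrow> ereal \<Rightarrow> (real \<Rightarrow> real \<Rightarrow> real) \<Rightarrow> bool" where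
  "sobolev_curve s T f \<longleftrightarrow>
     (\<forall>t\<in>time_interval T. f t \<in> sobolev_cont s \<and>
        ((\<lambda>\<tau>. sobolev_norm s (\<lambda>x. f \<tau> x - f t x)) \<longlongrightarrow> 0) (at t within time_interval T))"

section \<open>The system\<close>

text \<open>
  Test functions \<open>C\<^sub>c\<^sup>\<infinity>((0,T) \<times> \<real>)\<close>; \<open>D i j\<close> is the partial derivative of order \<open>i\<close> in \<open>t\<close> and
  of order \<open>j\<close> in \<open>x\<close>.
\<close>

definition test_function :: "ereal \<Rightarrow> (real \<Rightarrow> real \<Rightarrow> real) \<Rightarrow> bool" where
  "test_function T \<phi> \<longleftrightarrow>
     (\<exists>D :: nat \<Rightarrow> nat \<Rightarrow> real \<Rightarrow> real \<Rightarrow> real. D 0 0 = \<phi> \<and>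
        (\<forall>i j. continuous_on UNIV (\<lambda>(t, x). D i j t x) \<and>
           (\<forall>t x. ((\<lambda>\<tau>. D i j \<tau> x) has_real_derivative D (Suc i) j t x) (at t) \<and>
                  ((\<lambda>y. D i j t y) has_real_derivative D i (Suc j) t x) (at x)))) \<and>
     (\<exists>K. compact K \<and> K \<subseteq> {(t, x). 0 < t \<and> ereal t < T} \<and>
        (\<forall>t x. (t, x) \<notin> K \<longrightarrow> \<phi> t x = 0))"

text \<open>
  \<open>f\<^sub>t + c g\<^sub>x + h = 0\<close> in the sense of distributions on \<open>(0,T) \<times> \<real>\<close>, where \<open>f\<close>, \<open>g\<close>, \<open>h\<close> are
  functions and \<open>c\<close> is differentiable in \<open>x\<close>. The distributional reading is needed because
  \<open>m\<^sub>t\<close> and \<open>m\<^sub>x\<close> lie in \<open>H\<^bsup>s-3\<^esup>(\<real>)\<close>, which for \<open>s < 3\<close> does not consist of functions; the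
  product \<open>c g\<^sub>x\<close> acts on \<open>\<phi>\<close> as \<open>g\<^sub>x\<close> acts on \<open>c \<phi>\<close>.
\<close>

definition weak_equation ::
  "ereal \<Rightarrow> (real \<Rightarrow> real \<Rightarrow> real) \<Rightarrow> (real \<Rightarrow> real \<Rightarrow> real) \<Rightarrow> (real \<Rightarrow> real \<Rightarrow> real)
     \<Rightarrow> (real \<Rightarrow> real \<Rightarrow> real) \<Rightarrow> bool" where
  "weak_equation T f c g h \<longleftrightarrow>
     (\<forall>\<phi>. test_function T \<phi> \<longrightarrow>
        (LINT t|lborel. LINT x|lborel.
            f t x * deriv (\<lambda>\<tau>. \<phi> \<tau> x) t
          + g t x * deriv (\<lambda>y. c t y * \<phi> t y) x
          - h t x * \<phi> t x) = 0)"

definition solution ::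
  "real \<Rightarrow> ereal \<Rightarrow> (real \<Rightarrow> real) \<Rightarrow> (real \<Rightarrow> real) \<Rightarrow> (real \<Rightarrow> real)
     \<Rightarrow> (real \<Rightarrow> real \<Rightarrow> real) \<Rightarrow> (real \<Rightarrow> real \<Rightarrow> real) \<Rightarrow> (real \<Rightarrow> real \<Rightarrow> real) \<Rightarrow> bool" where
  "solution s T \<rho>0 u0 v0 \<rho> u v \<longleftrightarrow>
     sobolev_curve (s - 1) T \<rho> \<and> sobolev_curve s T u \<and> sobolev_curve s T v \<and>
     \<rho> 0 = \<rho>0 \<and> u 0 = u0 \<and> v 0 = v0 \<and>
     (let m = (\<lambda>t x. u t x - deriv (deriv (u t)) x);
          n = (\<lambda>t x. v t x - deriv (deriv (v t)) x)
      in weak_equation T \<rho> (\<lambda>t x. 1) (\<lambda>t x. \<rho> t x * u t x * v t x) (\<lambda>t x. 0) \<and>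
         weak_equation T m (\<lambda>t x. u t x * v t x) m
           (\<lambda>t x. 3 * v t x * deriv (u t) x * m t x + (\<rho> t x)\<^sup>2 * u t x) \<and>
         weak_equation T n (\<lambda>t x. u t x * v t x) n
           (\<lambda>t x. 3 * deriv (v t) x * u t x * n t x - (\<rho> t x)\<^sup>2 * v t x))"

definition lifespan ::
  "real \<Rightarrow> (real \<Rightarrow> real) \<Rightarrow> (real \<Rightarrow> real) \<Rightarrow> (real \<Rightarrow> real) \<Rightarrow> ereal" where
  "lifespan s \<rho>0 u0 v0 = Sup {T. 0 < T \<and> (\<exists>\<rho> u v. solution s T \<rho>0 u0 v0 \<rho> u v)}"

definition log_weight :: "real \<Rightarrow> real \<Rightarrow> real \<Rightarrow> real" where
  "log_weight \<beta> \<alpha> x = (ln (exp 1 + \<beta> + \<bar>x\<bar>)) powr (- \<alpha>)"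

end

theory Submission
  imports Defs "HOL-Probability.Characteristic_Functions"
begin

text \<open>
  The first equation transports \<open>\<rho>\<close> with velocity \<open>u v\<close>, which is bounded together with its
  \<open>x\<close>-derivative for short times, since \<open>H\<^sup>s(\<real>)\<close> embeds into \<open>C\<^sup>1\<close> with bounded derivative. Hence
  \<open>\<bar>\<rho>(t,x)\<bar> \<le> e\<^bsup>(M+1)t\<^esup> sup {\<bar>\<rho>\<^sub>0(y)\<bar> : \<bar>y - x\<bar> \<le> M t}\<close>, and the logarithmic weight changes only by
  a bounded factor over bounded distances, so \<open>\<rho>\<close> inherits the decay of \<open>\<rho>\<^sub>0\<close>. The
  bound comes from a maximum principle on backward cones, which replaces the flow of the
  velocity field; the embedding comes from Fourier inversion with Gaussian damping.
\<close>

section \<open>Calculus on the real line\<close>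

text \<open>The obstacle is that \<open>\<rho>\<close> solves its equation only as a distribution,
  so no time derivative is available. But its values lie in H^(s-1) with s - 1 > 3/2, hence are C^1
  in x, and the flux has a jointly continuous x-derivative \<open>h\<close>. This suffices for an
  equation integrated in time at each fixed y, and the maximum principle is arranged to need no
  more: a step back along the characteristic is split into a spatial shift at time t, governed by
  the x-derivative of \<open>\<rho>\<close>, and a time increment at the shifted position, governed
  by the integrated equation. The constants \<open>M\<close> and \<open>T0\<close> come from
  continuity in the Sobolev norm at time 0 alone. In the embedding, the transform is only an L2
  limit of truncated integrals; pairing it with a damped exponential makes every integral absolutely
  convergent, and continuity of the representative gives the inversion formula at every point
  instead of almost everywhere.\<close>

lemma continuous_on_slice:
  assumes "continuous_on (A \<times> B) (\<lambda>(t, x). f t x)"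
  shows continuous_on_slice_fst: "x \<in> B \<Longrightarrow> continuous_on A (\<lambda>t. f t x)"
    and continuous_on_slice_snd: "t \<in> A \<Longrightarrow> continuous_on B (f t)"
proof -
  have "continuous_on A (\<lambda>t. case (t, x) of (t, x) \<Rightarrow> f t x)" if "x \<in> B"
    by (rule continuous_on_compose2[OF assms]) (use that in \<open>auto intro!: continuous_intros\<close>)
  then show "x \<in> B \<Longrightarrow> continuous_on A (\<lambda>t. f t x)" by simp
  have "continuous_on B (\<lambda>x. case (t, x) of (t, x) \<Rightarrow> f t x)" if "t \<in> A"
    by (rule continuous_on_compose2[OF assms]) (use that in \<open>auto intro!: continuous_intros\<close>)
  then show "t \<in> A \<Longrightarrow> continuous_on B (f t)" by simp
qed

lemma has_integral_real_derivative:
  fixes f F :: "real \<Rightarrow> real"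
  assumes "a \<le> b" "\<And>x. x \<in> {a..b} \<Longrightarrow> (F has_real_derivative f x) (at x within {a..b})"
  shows "(f has_integral (F b - F a)) {a..b}"
  using assms by (intro fundamental_theorem_of_calculus)
    (simp_all add: has_real_derivative_iff_has_vector_derivative)

text \<open>Averaging against a probability density cannot leave an interval that contains the
  averaged values. Closeness is required only where \<open>k x \<noteq> 0\<close>, so the interval
  of integration may exceed the support of the mollifier, as it does for the time window
  below.\<close>

lemma weighted_mean_close:
  fixes k g :: "real \<Rightarrow> real"
  assumes "continuous_on {a..b} k" "continuous_on {a..b} g" "(k has_integral 1) {a..b}"
    and "\<And>x. x \<in> {a..b} \<Longrightarrow> 0 \<le> k x"
    and close: "\<And>x. x \<in> {a..b} \<Longrightarrow> k x \<noteq> 0 \<Longrightarrow> \<bar>g x - L\<bar> \<le> \<delta>"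
  shows "\<bar>integral {a..b} (\<lambda>x. k x * g x) - L\<bar> \<le> \<delta>"
proof -
  have "((\<lambda>x. k x * g x) has_integral integral {a..b} (\<lambda>x. k x * g x)) {a..b}"
    by (intro integrable_integral integrable_continuous_interval continuous_intros assms)
  from has_integral_diff[OF this has_integral_mult_left[OF assms(3), of L]]
  have g: "((\<lambda>x. k x * (g x - L)) has_integral (integral {a..b} (\<lambda>x. k x * g x) - L)) {a..b}"
    by (simp add: right_diff_distrib)
  have "k x * - \<delta> \<le> k x * (g x - L)" "k x * (g x - L) \<le> k x * \<delta>" if "x \<in> {a..b}" for x
  proof -
    have "k x = 0 \<or> - \<delta> \<le> g x - L \<and> g x - L \<le> \<delta>"
      using close[OF that] by (auto simp: abs_le_iff)
    then show "k x * - \<delta> \<le> k x * (g x - L)" "k x * (g x - L) \<le> k x * \<delta>"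
      using assms(4)[OF that] mult_left_mono[of "- \<delta>" "g x - L" "k x"]
        mult_left_mono[of "g x - L" \<delta> "k x"] by auto
  qed
  then have "1 * - \<delta> \<le> integral {a..b} (\<lambda>x. k x * g x) - L"
    "integral {a..b} (\<lambda>x. k x * g x) - L \<le> 1 * \<delta>"
    using has_integral_le[OF has_integral_mult_left[OF assms(3), of "-\<delta>"] g]
      has_integral_le[OF g has_integral_mult_left[OF assms(3), of \<delta>]] by simp_all
  then show ?thesis by (simp add: abs_le_iff)
qed

text \<open>The bridge from the Lebesgue integrals of the weak equation to the gauge integrals that
  carry the fundamental theorem of calculus. Continuity is asked of \<open>f\<close> on
  \<open>{a..b}\<close> only, because solutions have arbitrary values at times outside [0,T), where
  the test function makes the integrand vanish.\<close>

lemma LINT_supported_Icc: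
  fixes f :: "real \<Rightarrow> real"
  assumes "continuous_on {a..b} f" "\<And>x. x \<notin> {a..b} \<Longrightarrow> F x = 0" "\<And>x. x \<in> {a..b} \<Longrightarrow> F x = f x"
  shows "(LINT x|lborel. F x) = integral {a..b} f"
proof -
  have "F = (\<lambda>x. indicator {a..b} x *\<^sub>R f x)"
    using assms(2,3) by (auto simp: fun_eq_iff indicator_def)
  then have "(LINT x|lborel. F x) = (LINT x:{a..b}|lborel. f x)"
    by (simp add: set_lebesgue_integral_def)
  also have "\<dots> = integral {a..b} f"
    by (rule set_borel_integral_eq_integral(2)[OF borel_integrable_atLeastAtMost'[OF assms(1)]])
  finally show ?thesis .
qed

lemma continuous_on_LINT:
  fixes k :: "real \<Rightarrow> real \<Rightarrow> real"
  assumes meas: "\<And>x. k x \<in> borel_measurable M" and cont: "\<And>\<xi>. continuous_on UNIV (\<lambda>x. k x \<xi>)"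
    and bound: "\<And>x \<xi>. \<bar>k x \<xi>\<bar> \<le> g \<xi>" and g: "integrable M g"
  shows "continuous_on UNIV (\<lambda>x. LINT \<xi>|M. k x \<xi>)"
proof (rule continuous_on_sequentiallyI)
  fix u :: "nat \<Rightarrow> real" and a assume u: "u \<longlonglongrightarrow> a"
  show "(\<lambda>n. LINT \<xi>|M. k (u n) \<xi>) \<longlonglongrightarrow> (LINT \<xi>|M. k a \<xi>)"
  proof (rule integral_dominated_convergence[OF meas meas g])
    show "AE \<xi> in M. (\<lambda>n. k (u n) \<xi>) \<longlonglongrightarrow> k a \<xi>"
      by (intro AE_I2 continuous_on_tendsto_compose[OF cont u]) auto
  qed (use bound in auto)
qed

text \<open>The mean value inequality turns the bound on \<open>k'\<close> into the same bound
  \<open>g\<close> on all difference quotients, so dominated convergence applies along every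
  sequence tending to x.\<close>

lemma DERIV_LINT:
  fixes k k' :: "real \<Rightarrow> real \<Rightarrow> real"
  assumes int: "\<And>x. integrable M (k x)" and meas: "\<And>x. k' x \<in> borel_measurable M"
    and deriv: "\<And>x \<xi>. ((\<lambda>x. k x \<xi>) has_real_derivative k' x \<xi>) (at x)"
    and bound: "\<And>x \<xi>. \<bar>k' x \<xi>\<bar> \<le> g \<xi>" and g: "integrable M g"
  shows "((\<lambda>x. LINT \<xi>|M. k x \<xi>) has_real_derivative (LINT \<xi>|M. k' x \<xi>)) (at x)"
  unfolding has_field_derivative_iff
proof (rule tendsto_at_iff_sequentially[THEN iffD2], intro allI impI, unfold comp_def)
  fix u assume u: "\<forall>i. u i \<in> UNIV - {x}" "u \<longlonglongrightarrow> x"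
  have quot: "((LINT \<xi>|M. k (u n) \<xi>) - (LINT \<xi>|M. k x \<xi>)) / (u n - x) = (LINT \<xi>|M. (k (u n) \<xi> - k x \<xi>) / (u n - x))" for n
    by (simp add: Bochner_Integration.integral_diff[OF int int] int)
  show "(\<lambda>n. ((LINT \<xi>|M. k (u n) \<xi>) - (LINT \<xi>|M. k x \<xi>)) / (u n - x)) \<longlonglongrightarrow> (LINT \<xi>|M. k' x \<xi>)"
    unfolding quot
  proof (rule integral_dominated_convergence[OF meas _ g])
    show "(\<lambda>\<xi>. (k (u n) \<xi> - k x \<xi>) / (u n - x)) \<in> borel_measurable M" for n
      by (intro borel_measurable_divide borel_measurable_diff borel_measurable_const borel_measurable_integrable[OF int])
    show "AE \<xi> in M. (\<lambda>n. (k (u n) \<xi> - k x \<xi>) / (u n - x)) \<longlonglongrightarrow> k' x \<xi>"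
    proof (intro AE_I2)
      fix \<xi>
      from deriv[of \<xi> x] have "((\<lambda>y. (k y \<xi> - k x \<xi>) / (y - x)) \<longlongrightarrow> k' x \<xi>) (at x)"
        by (simp add: has_field_derivative_iff)
      from this[unfolded tendsto_at_iff_sequentially, rule_format, OF u(1)[rule_format] u(2)]
      show "(\<lambda>n. (k (u n) \<xi> - k x \<xi>) / (u n - x)) \<longlonglongrightarrow> k' x \<xi>"
        by (simp only: comp_def)
    qed
    show "AE \<xi> in M. norm ((k (u n) \<xi> - k x \<xi>) / (u n - x)) \<le> g \<xi>" for n
    proof (intro AE_I2)
      fix \<xi>
      have "norm (k (u n) \<xi> - k x \<xi>) \<le> g \<xi> * norm (u n - x)"
      proof (rule field_differentiable_bound[of UNIV "\<lambda>x. k x \<xi>" "\<lambda>x. k' x \<xi>"])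
        show "((\<lambda>x. k x \<xi>) has_field_derivative k' z \<xi>) (at z within UNIV)" for z by (rule deriv)
        show "norm (k' z \<xi>) \<le> g \<xi>" for z using bound[of z \<xi>] by simp
      qed auto
      moreover have "norm (u n - x) > 0" using u(1) by simp
      ultimately show "norm ((k (u n) \<xi> - k x \<xi>) / (u n - x)) \<le> g \<xi>"
        unfolding norm_divide by (simp only: pos_divide_le_eq)
    qed
  qed
qed

section \<open>The Sobolev embedding\<close>

text \<open>Comparison with the tail \<open>x powr (- 2 * p)\<close>, for which p = 1/2 is the
  threshold of convergence. Taken at p = s - 1, this is the source of the condition s > 3/2 in the
  embedding.\<close>

lemma integrable_one_plus_square_powr:
  assumes "p > 1 / 2"
  shows "integrable lborel (\<lambda>\<xi>::real. (1 + \<xi>\<^sup>2) powr (- p))"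
proof -
  define g :: "real \<Rightarrow> real" where "g = (\<lambda>x. indicator {1..} x * x powr (- 2 * p))"
  have "(\<lambda>x::real. x powr (- 2 * p)) integrable_on {1..}"
    using has_integral_powr_to_inf[of "- 2 * p" 1] assms by auto
  then have "(\<lambda>x::real. x powr (- 2 * p)) absolutely_integrable_on {1..}"
    by (rule nonnegative_absolutely_integrable_1) simp
  then have g: "integrable lborel g"
    unfolding set_integrable_def g_def by (subst (asm) integrable_completion) auto
  \<comment> \<open>The left tail is the reflection of the right one; the terms
    \<open>0 + 1 * x\<close> and \<open>0 + (-1) * x\<close> keep the shape of the affine
    substitution rule.\<close>
  have "integrable lborel (\<lambda>x. indicator {-1..1} x + (g (0 + 1 * x) + g (0 + (-1) * x)))"
    by (intro Bochner_Integration.integrable_add lborel_integrable_real_affine g)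
      (auto simp: emeasure_lborel_Icc_eq)
  then show ?thesis
  proof (rule Bochner_Integration.integrable_bound)
    have "(1 + \<xi>\<^sup>2) powr (- p) \<le> indicator {-1..1} \<xi> + (g (0 + 1 * \<xi>) + g (0 + (-1) * \<xi>))" for \<xi> :: real
    proof (cases "\<bar>\<xi>\<bar> \<le> 1")
      case True
      have "(1 + \<xi>\<^sup>2) powr (- p) \<le> (1 + \<xi>\<^sup>2) powr 0"
        using assms by (intro powr_mono) auto
      then have "(1 + \<xi>\<^sup>2) powr (- p) \<le> 1" by (simp add: add_nonneg_eq_0_iff split: if_splits)
      moreover have "0 \<le> g y" for y by (simp add: g_def indicator_def)
      moreover have "indicator {-1..1} \<xi> = (1::real)" using True by (simp add: indicator_def abs_le_iff)
      ultimately show ?thesis by (metis add_increasing2 add_nonneg_nonneg)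
    next
      case False
      have "(1 + \<xi>\<^sup>2) powr (- p) \<le> (\<bar>\<xi>\<bar> powr 2) powr (- p)"
        using assms False by (intro powr_mono2') auto
      also have "\<dots> = \<bar>\<xi>\<bar> powr (- 2 * p)"
        by (subst powr_powr) simp
      also have "\<dots> \<le> indicator {-1..1} \<xi> + (g (0 + 1 * \<xi>) + g (0 + (-1) * \<xi>))"
        using False by (auto simp: g_def indicator_def abs_if)
      finally show ?thesis .
    qed
    then show "AE \<xi> in lborel. norm ((1 + \<xi>\<^sup>2) powr (- p)) \<le>
        norm (indicator {-1..1} \<xi> + (g (0 + 1 * \<xi>) + g (0 + (-1) * \<xi>)))" for \<xi> :: real
      by (intro AE_I2) (smt (verit) powr_ge_zero real_norm_def)
  qed measurable
qed

section \<open>Truncated Fourier integrals; uniqueness and linearity of the L2 transform\<close>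

lemma borel_measurable_cis [measurable (raw)]:
  fixes f :: "'a \<Rightarrow> real"
  assumes "f \<in> borel_measurable M"
  shows "(\<lambda>x. cis (f x)) \<in> borel_measurable M"
  using measurable_compose[OF assms borel_measurable_continuous_onI[of cis]]
  by (simp add: continuous_on_cis continuous_on_id)

text \<open>From |y| <= 1 + y^2, the constant being integrable on a bounded interval. Hence
  truncated Fourier integrals converge absolutely although f itself is only in L2.\<close>

lemma square_integrable_imp_integrable_Icc:
  fixes f :: "real \<Rightarrow> real"
  assumes "square_integrable f"
  shows "integrable lborel (\<lambda>x. indicator {a..b} x * f x)"
proof -
  from assms have [measurable]: "f \<in> borel_measurable lborel" by (simp add: square_integrable_def)
  have "integrable lborel (\<lambda>x. indicator {a..b} x + (f x)\<^sup>2)"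
    using assms by (intro Bochner_Integration.integrable_add)
      (auto simp: square_integrable_def emeasure_lborel_Icc_eq)
  then show ?thesis
  proof (rule Bochner_Integration.integrable_bound)
    have "\<bar>y\<bar> \<le> 1 + y\<^sup>2" for y :: real
      using sum_squares_bound[of 1 "\<bar>y\<bar>"] by (simp add: power2_eq_square)
    then show "AE x in lborel. norm (indicator {a..b} x * f x) \<le> norm (indicator {a..b} x + (f x)\<^sup>2)"
      by (intro AE_I2) (auto simp: indicator_def)
  qed measurable
qed

lemma truncated_fourier_alt:
  "truncated_fourier f R \<xi> = complex_of_real (1 / sqrt (2 * pi)) *
     (LINT x|lborel. complex_of_real (indicator {-R..R} x * f x) * cis (- (x * \<xi>)))"
  unfolding truncated_fourier_def set_lebesgue_integral_def
  by (intro arg_cong2[where f = "(*)"] Bochner_Integration.integral_cong refl)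
    (auto simp: indicator_def)

lemma truncated_fourier_measurable [measurable]:
  assumes [measurable]: "f \<in> borel_measurable lborel"
  shows "truncated_fourier f R \<in> borel_measurable lborel"
  unfolding truncated_fourier_alt[abs_def] by measurable

lemma truncated_fourier_integrable:
  assumes "square_integrable f"
  shows "integrable lborel (\<lambda>x. complex_of_real (indicator {-R..R} x * f x) * cis (- (x * \<xi>)))"
proof -
  from assms have [measurable]: "f \<in> borel_measurable lborel" by (simp add: square_integrable_def)
  show ?thesis
    by (rule Bochner_Integration.integrable_bound[OF square_integrable_imp_integrable_Icc[OF assms, of "-R" R]])
      (auto simp: norm_mult)
qed

lemma truncated_fourier_diff:
  assumes "square_integrable f" "square_integrable g"
  shows "truncated_fourier (\<lambda>x. f x - g x) R \<xi> = truncated_fourier f R \<xi> - truncated_fourier g R \<xi>"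
proof -
  have "complex_of_real (indicator {-R..R} x * (f x - g x)) * cis (- (x * \<xi>)) =
      complex_of_real (indicator {-R..R} x * f x) * cis (- (x * \<xi>)) -
      complex_of_real (indicator {-R..R} x * g x) * cis (- (x * \<xi>))" for x
    by (simp add: algebra_simps)
  then show ?thesis
    unfolding truncated_fourier_alt right_diff_distrib[symmetric]
    by (simp only: Bochner_Integration.integral_diff[OF truncated_fourier_integrable truncated_fourier_integrable] assms)
qed

lemma ennreal_norm_diff_square_le:
  fixes a b c d :: "'a::real_normed_vector"
  shows "ennreal ((norm ((a - b) - (c - d)))\<^sup>2) \<le>
    2 * ennreal ((norm (a - c))\<^sup>2) + 2 * ennreal ((norm (b - d))\<^sup>2)"
proof -
  have "norm ((a - b) - (c - d)) \<le> norm (a - c) + norm (b - d)"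
    using norm_triangle_ineq4[of "a - c" "b - d"] by (simp add: algebra_simps)
  then have "(norm ((a - b) - (c - d)))\<^sup>2 \<le> (norm (a - c) + norm (b - d))\<^sup>2"
    by (intro power_mono) auto
  also have "\<dots> \<le> 2 * (norm (a - c))\<^sup>2 + 2 * (norm (b - d))\<^sup>2"
    using sum_squares_bound[of "norm (a - c)" "norm (b - d)"] by (simp add: power2_sum)
  finally have "ennreal ((norm ((a - b) - (c - d)))\<^sup>2) \<le> ennreal (2 * (norm (a - c))\<^sup>2 + 2 * (norm (b - d))\<^sup>2)"
    by (rule ennreal_leI)
  then show ?thesis by (simp add: ennreal_plus ennreal_mult)
qed

text \<open>Used twice: with the same truncated transform for \<open>C\<close> and \<open>D\<close>
  it yields uniqueness, with the transforms of two functions it yields linearity. Nonnegative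
  integrals spare all integrability conditions, as a distance may be infinite for some R.\<close>

lemma nn_integral_norm_diff_square_tendsto_0:
  fixes A B C D :: "real \<Rightarrow> real \<Rightarrow> complex"
  assumes [measurable]: "\<And>R. A R \<in> borel_measurable lborel" "\<And>R. B R \<in> borel_measurable lborel"
      "\<And>R. C R \<in> borel_measurable lborel" "\<And>R. D R \<in> borel_measurable lborel"
    and "((\<lambda>R. \<integral>\<^sup>+ \<xi>. ennreal ((norm (A R \<xi> - C R \<xi>))\<^sup>2) \<partial>lborel) \<longlongrightarrow> 0) at_top"
    and "((\<lambda>R. \<integral>\<^sup>+ \<xi>. ennreal ((norm (B R \<xi> - D R \<xi>))\<^sup>2) \<partial>lborel) \<longlongrightarrow> 0) at_top"
  shows "((\<lambda>R. \<integral>\<^sup>+ \<xi>. ennreal ((norm ((A R \<xi> - B R \<xi>) - (C R \<xi> - D R \<xi>)))\<^sup>2) \<partial>lborel) \<longlongrightarrow> 0) at_top"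
proof (rule tendsto_sandwich[OF _ _ tendsto_const])
  show "((\<lambda>R. 2 * (\<integral>\<^sup>+ \<xi>. ennreal ((norm (A R \<xi> - C R \<xi>))\<^sup>2) \<partial>lborel) +
      2 * (\<integral>\<^sup>+ \<xi>. ennreal ((norm (B R \<xi> - D R \<xi>))\<^sup>2) \<partial>lborel)) \<longlongrightarrow> 0) at_top"
    using tendsto_add[OF ennreal_tendsto_cmult[OF _ assms(5), of 2] ennreal_tendsto_cmult[OF _ assms(6), of 2]]
    by simp
  have "(\<integral>\<^sup>+ \<xi>. ennreal ((norm ((A R \<xi> - B R \<xi>) - (C R \<xi> - D R \<xi>)))\<^sup>2) \<partial>lborel) \<le>
      (\<integral>\<^sup>+ \<xi>. (2 * ennreal ((norm (A R \<xi> - C R \<xi>))\<^sup>2) + 2 * ennreal ((norm (B R \<xi> - D R \<xi>))\<^sup>2)) \<partial>lborel)" for R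
    by (intro nn_integral_mono ennreal_norm_diff_square_le)
  also have "(\<integral>\<^sup>+ \<xi>. (2 * ennreal ((norm (A R \<xi> - C R \<xi>))\<^sup>2) + 2 * ennreal ((norm (B R \<xi> - D R \<xi>))\<^sup>2)) \<partial>lborel)
      = 2 * (\<integral>\<^sup>+ \<xi>. ennreal ((norm (A R \<xi> - C R \<xi>))\<^sup>2) \<partial>lborel) +
        2 * (\<integral>\<^sup>+ \<xi>. ennreal ((norm (B R \<xi> - D R \<xi>))\<^sup>2) \<partial>lborel)" for R
    by (simp add: nn_integral_add nn_integral_cmult)
  finally show "\<forall>\<^sub>F R in at_top. (\<integral>\<^sup>+ \<xi>. ennreal ((norm ((A R \<xi> - B R \<xi>) - (C R \<xi> - D R \<xi>)))\<^sup>2) \<partial>lborel)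
      \<le> 2 * (\<integral>\<^sup>+ \<xi>. ennreal ((norm (A R \<xi> - C R \<xi>))\<^sup>2) \<partial>lborel) +
        2 * (\<integral>\<^sup>+ \<xi>. ennreal ((norm (B R \<xi> - D R \<xi>))\<^sup>2) \<partial>lborel)"
    by simp
qed simp

lemma has_fourier_L2_measurable:
  assumes "has_fourier_L2 f F"
  shows "f \<in> borel_measurable lborel" "F \<in> borel_measurable lborel"
  using assms by (auto simp: has_fourier_L2_def square_integrable_def)

text \<open>Both transforms are approached by the same truncated integrals, which cancel. What
  remains does not depend on the cutoff and tends to 0, so it is 0.\<close>

lemma has_fourier_L2_unique:
  assumes "has_fourier_L2 f F" "has_fourier_L2 f F'"
  shows "AE \<xi> in lborel. F \<xi> = F' \<xi>"
proof -
  note [measurable] = has_fourier_L2_measurable[OF assms(1)] has_fourier_L2_measurable[OF assms(2)]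
  have "((\<lambda>R::real. \<integral>\<^sup>+ \<xi>. ennreal ((norm ((F \<xi> - F' \<xi>) - (truncated_fourier f R \<xi> - truncated_fourier f R \<xi>)))\<^sup>2) \<partial>lborel)
      \<longlongrightarrow> 0) at_top"
    by (rule nn_integral_norm_diff_square_tendsto_0) (use assms in \<open>auto simp: has_fourier_L2_def\<close>)
  then have "((\<lambda>R::real. \<integral>\<^sup>+ \<xi>. ennreal ((norm (F \<xi> - F' \<xi>))\<^sup>2) \<partial>lborel) \<longlongrightarrow> 0) at_top"
    by simp
  then have "(\<integral>\<^sup>+ \<xi>. ennreal ((norm (F \<xi> - F' \<xi>))\<^sup>2) \<partial>lborel) = 0"
    by (simp add: tendsto_const_iff)
  then have "AE \<xi> in lborel. ennreal ((norm (F \<xi> - F' \<xi>))\<^sup>2) = 0"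
    by (subst (asm) nn_integral_0_iff_AE) auto
  then show ?thesis
    by eventually_elim (simp add: ennreal_eq_0_iff)
qed

lemma integrable_norm_diff_square:
  fixes F G :: "real \<Rightarrow> 'a::{banach, second_countable_topology}"
  assumes [measurable]: "F \<in> borel_measurable lborel" "G \<in> borel_measurable lborel" "w \<in> borel_measurable lborel"
    and "integrable lborel (\<lambda>\<xi>. w \<xi> * (norm (F \<xi>))\<^sup>2)" "integrable lborel (\<lambda>\<xi>. w \<xi> * (norm (G \<xi>))\<^sup>2)"
    and "\<And>\<xi>. 0 \<le> w \<xi>"
  shows "integrable lborel (\<lambda>\<xi>. w \<xi> * (norm (F \<xi> - G \<xi>))\<^sup>2)"
proof (rule Bochner_Integration.integrable_bound)
  show "integrable lborel (\<lambda>\<xi>. 2 * (w \<xi> * (norm (F \<xi>))\<^sup>2) + 2 * (w \<xi> * (norm (G \<xi>))\<^sup>2))"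
    using assms by auto
  have "(norm (F \<xi> - G \<xi>))\<^sup>2 \<le> 2 * (norm (F \<xi>))\<^sup>2 + 2 * (norm (G \<xi>))\<^sup>2" for \<xi>
  proof -
    have "(norm (F \<xi> - G \<xi>))\<^sup>2 \<le> (norm (F \<xi>) + norm (G \<xi>))\<^sup>2"
      by (intro power_mono norm_triangle_ineq4) auto
    also have "\<dots> \<le> 2 * (norm (F \<xi>))\<^sup>2 + 2 * (norm (G \<xi>))\<^sup>2"
      using sum_squares_bound[of "norm (F \<xi>)" "norm (G \<xi>)"] by (simp add: power2_sum)
    finally show ?thesis .
  qed
  then have "w \<xi> * (norm (F \<xi> - G \<xi>))\<^sup>2 \<le> w \<xi> * (2 * (norm (F \<xi>))\<^sup>2 + 2 * (norm (G \<xi>))\<^sup>2)" for \<xi>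
    by (intro mult_left_mono assms)
  then show "AE \<xi> in lborel. norm (w \<xi> * (norm (F \<xi> - G \<xi>))\<^sup>2) \<le>
      norm (2 * (w \<xi> * (norm (F \<xi>))\<^sup>2) + 2 * (w \<xi> * (norm (G \<xi>))\<^sup>2))"
    using assms(6) by (intro AE_I2) (simp add: algebra_simps abs_mult)
qed measurable

lemma has_fourier_L2_diff:
  assumes "has_fourier_L2 f F" "has_fourier_L2 g G"
  shows "has_fourier_L2 (\<lambda>x. f x - g x) (\<lambda>\<xi>. F \<xi> - G \<xi>)"
proof -
  note [measurable] = has_fourier_L2_measurable[OF assms(1)] has_fourier_L2_measurable[OF assms(2)]
  have sq: "square_integrable f" "square_integrable g" "square_integrable F" "square_integrable G"
    using assms by (auto simp: has_fourier_L2_def)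
  have "square_integrable (\<lambda>x. f x - g x)" "square_integrable (\<lambda>x. F x - G x)"
    using sq integrable_norm_diff_square[of f g "\<lambda>_. 1"] integrable_norm_diff_square[of F G "\<lambda>_. 1"]
    by (auto simp: square_integrable_def)
  moreover have "((\<lambda>R. \<integral>\<^sup>+ \<xi>. ennreal ((norm ((F \<xi> - G \<xi>) - (truncated_fourier f R \<xi> - truncated_fourier g R \<xi>)))\<^sup>2) \<partial>lborel)
      \<longlongrightarrow> 0) at_top"
    by (rule nn_integral_norm_diff_square_tendsto_0) (use assms in \<open>auto simp: has_fourier_L2_def\<close>)
  ultimately show ?thesis
    by (simp add: has_fourier_L2_def truncated_fourier_diff[OF sq(1,2)])
qed

text \<open>Continuity in time is expressed by norms of differences of two time slices, so the
  embedding has to be applicable to such differences.\<close>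

lemma sobolev_cont_diff:
  assumes "f \<in> sobolev_cont s" "g \<in> sobolev_cont s"
  shows "(\<lambda>x. f x - g x) \<in> sobolev_cont s"
proof -
  obtain F G where "has_fourier_L2 f F" "integrable lborel (\<lambda>\<xi>. (1 + \<xi>\<^sup>2) powr s * (norm (F \<xi>))\<^sup>2)"
    "has_fourier_L2 g G" "integrable lborel (\<lambda>\<xi>. (1 + \<xi>\<^sup>2) powr s * (norm (G \<xi>))\<^sup>2)"
    using assms by (auto simp: sobolev_cont_def sobolev_def)
  moreover from this have "integrable lborel (\<lambda>\<xi>. (1 + \<xi>\<^sup>2) powr s * (norm (F \<xi> - G \<xi>))\<^sup>2)"
    by (intro integrable_norm_diff_square) (auto dest: has_fourier_L2_measurable)
  ultimately show ?thesis
    using assms has_fourier_L2_diff[of f F g G]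
    by (auto simp: sobolev_cont_def sobolev_def intro!: continuous_intros)
qed

text \<open>\<open>sobolev_norm\<close> selects a transform by Hilbert choice, whereas membership in
  \<open>sobolev s\<close> may supply a different one. By uniqueness they agree almost everywhere,
  so the selected one inherits integrability. Otherwise the integral in the norm could be the
  default value 0 and would bound nothing.\<close>

lemma sobolev_fourier:
  assumes "f \<in> sobolev s"
  obtains F where "has_fourier_L2 f F" "integrable lborel (\<lambda>\<xi>. (1 + \<xi>\<^sup>2) powr s * (norm (F \<xi>))\<^sup>2)"
    "(sobolev_norm s f)\<^sup>2 = (LINT \<xi>|lborel. (1 + \<xi>\<^sup>2) powr s * (norm (F \<xi>))\<^sup>2)" "0 \<le> sobolev_norm s f"
proof -
  define F where "F = (SOME F. has_fourier_L2 f F)"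
  obtain F' where F': "has_fourier_L2 f F'" "integrable lborel (\<lambda>\<xi>. (1 + \<xi>\<^sup>2) powr s * (norm (F' \<xi>))\<^sup>2)"
    using assms by (auto simp: sobolev_def)
  then have F: "has_fourier_L2 f F" unfolding F_def by (metis someI)
  note [measurable] = has_fourier_L2_measurable[OF F] has_fourier_L2_measurable[OF F'(1)]
  have "integrable lborel (\<lambda>\<xi>. (1 + \<xi>\<^sup>2) powr s * (norm (F \<xi>))\<^sup>2)"
    by (rule integrable_cong_AE_imp[OF F'(2)]) (use has_fourier_L2_unique[OF F F'(1)] in auto)
  moreover have "0 \<le> (LINT \<xi>|lborel. (1 + \<xi>\<^sup>2) powr s * (norm (F \<xi>))\<^sup>2)"
    by (rule Bochner_Integration.integral_nonneg) auto
  ultimately show thesis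
    using F by (intro that[of F]) (auto simp: sobolev_norm_def Let_def F_def[symmetric])
qed

section \<open>Fourier inversion with Gaussian damping\<close>

lemma integrable_gaussian:
  assumes "\<sigma> > 0"
  shows "integrable lborel (\<lambda>\<xi>::real. exp (- (\<sigma> * \<xi>)\<^sup>2 / 2))"
proof -
  have "exp (- (\<sigma> * \<xi>)\<^sup>2 / 2) = sqrt (2 * pi * (1 / \<sigma>)\<^sup>2) * normal_density 0 (1 / \<sigma>) \<xi>" for \<xi>
    using assms by (simp add: normal_density_def power_mult_distrib field_simps)
  then show ?thesis
    using assms by simp
qed

text \<open>The characteristic function of the standard normal law, rescaled by the substitution
  \<xi> = \<eta> / \<sigma>. Writing the result as a density of width \<sigma> prepares it to act as
  an approximate identity.\<close>

lemma fourier_gaussian: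
  assumes "\<sigma> > 0"
  shows "(LINT \<xi>|lborel. complex_of_real (exp (- (\<sigma> * \<xi>)\<^sup>2 / 2)) * cis (t * \<xi>)) =
    complex_of_real (2 * pi * normal_density 0 \<sigma> t)"
proof -
  have K: "(LINT \<xi>|lborel. complex_of_real (exp (- \<xi>\<^sup>2 / 2)) * cis (u * \<xi>)) =
      complex_of_real (sqrt (2 * pi) * exp (- u\<^sup>2 / 2))" for u
  proof -
    have "complex_of_real (exp (- u\<^sup>2 / 2)) = (LINT \<xi>|std_normal_distribution. cis (u * \<xi>))"
      using fun_cong[OF char_std_normal_distribution, of u] by (simp add: char_def cis_conv_exp)
    also have "\<dots> = (LINT \<xi>|lborel. std_normal_density \<xi> *\<^sub>R cis (u * \<xi>))"
      by (rule integral_density) (auto simp: normal_density_nonneg)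
    also have "\<dots> = (LINT \<xi>|lborel. complex_of_real (1 / sqrt (2 * pi)) * (complex_of_real (exp (- \<xi>\<^sup>2 / 2)) * cis (u * \<xi>)))"
      by (simp add: std_normal_density_def scaleR_conv_of_real mult.assoc)
    also have "\<dots> = complex_of_real (1 / sqrt (2 * pi)) * (LINT \<xi>|lborel. complex_of_real (exp (- \<xi>\<^sup>2 / 2)) * cis (u * \<xi>))"
      by (rule integral_mult_right_zero)
    finally show ?thesis by (simp add: field_simps)
  qed
  have "(LINT \<xi>|lborel. complex_of_real (exp (- (\<sigma> * \<xi>)\<^sup>2 / 2)) * cis (t * \<xi>)) =
      \<bar>1 / \<sigma>\<bar> *\<^sub>R (LINT \<xi>|lborel. complex_of_real (exp (- (\<sigma> * (0 + 1 / \<sigma> * \<xi>))\<^sup>2 / 2)) * cis (t * (0 + 1 / \<sigma> * \<xi>)))"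
    by (rule lborel_integral_real_affine) (use assms in simp)
  also have "\<dots> = (1 / \<sigma>) *\<^sub>R (LINT \<xi>|lborel. complex_of_real (exp (- \<xi>\<^sup>2 / 2)) * cis ((t / \<sigma>) * \<xi>))"
    using assms by simp
  also have "\<dots> = complex_of_real (1 / \<sigma> * (sqrt (2 * pi) * exp (- (t / \<sigma>)\<^sup>2 / 2)))"
    unfolding K by (simp add: scaleR_conv_of_real)
  also have "1 / \<sigma> * (sqrt (2 * pi) * exp (- (t / \<sigma>)\<^sup>2 / 2)) = 2 * pi * normal_density 0 \<sigma> t"
  proof -
    have "2 * pi / sqrt (2 * pi) = sqrt (2 * pi)" by (rule real_div_sqrt) simp
    then show ?thesis
      using assms by (simp add: normal_density_def real_sqrt_mult power_divide field_simps)
  qed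
  finally show ?thesis .
qed

text \<open>Fubini moves the transform from f to \<open>G\<close>. The cutoff makes the first factor
  integrable, which provides the integrability on the plane that Fubini requires.\<close>

lemma truncated_fourier_pairing:
  fixes G :: "real \<Rightarrow> complex"
  assumes f: "square_integrable f" and G: "integrable lborel G"
  shows "integrable lborel (\<lambda>\<xi>. truncated_fourier f R \<xi> * G \<xi>)"
    and "(LINT \<xi>|lborel. truncated_fourier f R \<xi> * G \<xi>) = complex_of_real (1 / sqrt (2 * pi)) *
      (LINT y|lborel. complex_of_real (indicator {-R..R} y * f y) * (LINT \<xi>|lborel. G \<xi> * cis (- (y * \<xi>))))"
proof -
  define c where "c = complex_of_real (1 / sqrt (2 * pi))"
  define a where "a = (\<lambda>y. complex_of_real (indicator {-R..R} y * f y))"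
  from f have [measurable]: "f \<in> borel_measurable lborel" by (simp add: square_integrable_def)
  have [measurable]: "G \<in> borel_measurable lborel" using G by simp
  have [measurable]: "a \<in> borel_measurable lborel" unfolding a_def by measurable
  have int_a: "integrable lborel a"
    unfolding a_def by (intro integrable_of_real square_integrable_imp_integrable_Icc f)
  have tf: "truncated_fourier f R \<xi> = c * (LINT y|lborel. a y * cis (- (y * \<xi>)))" for \<xi>
    by (simp add: truncated_fourier_alt a_def c_def)
  have bound: "norm (truncated_fourier f R \<xi>) \<le> norm c * (LINT y|lborel. norm (a y))" for \<xi>
    unfolding tf norm_mult
    using integral_norm_bound[of lborel "\<lambda>y. a y * cis (- (y * \<xi>))"]
    by (intro mult_left_mono) (auto simp: norm_mult)
  show "integrable lborel (\<lambda>\<xi>. truncated_fourier f R \<xi> * G \<xi>)"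
  proof (rule Bochner_Integration.integrable_bound)
    show "integrable lborel (\<lambda>\<xi>. (norm c * (LINT y|lborel. norm (a y))) * norm (G \<xi>))"
      using G by simp
    show "AE \<xi> in lborel. norm (truncated_fourier f R \<xi> * G \<xi>) \<le> norm ((norm c * (LINT y|lborel. norm (a y))) * norm (G \<xi>))"
    proof (intro AE_I2)
      fix \<xi>
      have "norm (truncated_fourier f R \<xi> * G \<xi>) \<le> (norm c * (LINT y|lborel. norm (a y))) * norm (G \<xi>)"
        unfolding norm_mult[of _ "G \<xi>"] by (intro mult_right_mono bound) simp
      then show "norm (truncated_fourier f R \<xi> * G \<xi>) \<le> norm ((norm c * (LINT y|lborel. norm (a y))) * norm (G \<xi>))"
        by (metis norm_ge_zero order_trans real_norm_def abs_of_nonneg)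
    qed
  qed measurable
  have prod: "integrable (lborel \<Otimes>\<^sub>M lborel) (\<lambda>(y, \<xi>). a y * (G \<xi> * cis (- (y * \<xi>))))"
  proof (rule lborel_pair.Fubini_integrable)
    show "integrable lborel (\<lambda>y. LINT \<xi>|lborel. norm (case (y, \<xi>) of (y, \<xi>) \<Rightarrow> a y * (G \<xi> * cis (- (y * \<xi>)))))"
      using int_a by (simp add: norm_mult)
    show "AE y in lborel. integrable lborel (\<lambda>\<xi>. case (y, \<xi>) of (y, \<xi>) \<Rightarrow> a y * (G \<xi> * cis (- (y * \<xi>))))"
    proof (intro AE_I2)
      fix y
      have "integrable lborel (\<lambda>\<xi>. G \<xi> * cis (- (y * \<xi>)))"
        by (rule Bochner_Integration.integrable_bound[OF G]) (auto simp: norm_mult)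
      then show "integrable lborel (\<lambda>\<xi>. case (y, \<xi>) of (y, \<xi>) \<Rightarrow> a y * (G \<xi> * cis (- (y * \<xi>))))"
        by simp
    qed
  qed measurable
  have "(LINT \<xi>|lborel. truncated_fourier f R \<xi> * G \<xi>) =
      (LINT \<xi>|lborel. c * (LINT y|lborel. a y * (G \<xi> * cis (- (y * \<xi>)))))"
  proof (rule Bochner_Integration.integral_cong[OF refl])
    fix \<xi>
    have "(LINT y|lborel. a y * (G \<xi> * cis (- (y * \<xi>)))) = (LINT y|lborel. a y * cis (- (y * \<xi>)) * G \<xi>)"
      by (simp add: ac_simps)
    then show "truncated_fourier f R \<xi> * G \<xi> = c * (LINT y|lborel. a y * (G \<xi> * cis (- (y * \<xi>))))"
      unfolding tf by simp
  qed
  also have "\<dots> = c * (LINT \<xi>|lborel. LINT y|lborel. a y * (G \<xi> * cis (- (y * \<xi>))))"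
    by simp
  also have "(LINT \<xi>|lborel. LINT y|lborel. a y * (G \<xi> * cis (- (y * \<xi>)))) =
      (LINT y|lborel. LINT \<xi>|lborel. a y * (G \<xi> * cis (- (y * \<xi>))))"
    by (rule lborel_pair.Fubini_integral[OF prod])
  finally show "(LINT \<xi>|lborel. truncated_fourier f R \<xi> * G \<xi>) = complex_of_real (1 / sqrt (2 * pi)) *
      (LINT y|lborel. complex_of_real (indicator {-R..R} y * f y) * (LINT \<xi>|lborel. G \<xi> * cis (- (y * \<xi>))))"
    by (simp add: a_def c_def)
qed

text \<open>Cauchy-Schwarz bounds the error by the L2 norm of \<open>G\<close> times the L2 distance
  between \<open>F\<close> and the truncated transform. \<open>G\<close> is in L2 because it is
  integrable and bounded by 1; the resulting finiteness of \<open>C\<close> is what lets the product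
  tend to 0 in the extended reals.\<close>

lemma fourier_pairing_tendsto:
  fixes G :: "real \<Rightarrow> complex"
  assumes F: "has_fourier_L2 f F" and G: "integrable lborel G" and bdd: "\<And>\<xi>. norm (G \<xi>) \<le> 1"
    and FG: "integrable lborel (\<lambda>\<xi>. F \<xi> * G \<xi>)"
  shows "((\<lambda>R. LINT \<xi>|lborel. truncated_fourier f R \<xi> * G \<xi>) \<longlongrightarrow> (LINT \<xi>|lborel. F \<xi> * G \<xi>)) at_top"
proof -
  note [measurable] = has_fourier_L2_measurable[OF F]
  have [measurable]: "G \<in> borel_measurable lborel" using G by simp
  have f: "square_integrable f" using F by (simp add: has_fourier_L2_def)
  define C where "C = (\<integral>\<^sup>+ \<xi>. (ennreal (norm (G \<xi>)))\<^sup>2 \<partial>lborel)"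
  have "C \<le> (\<integral>\<^sup>+ \<xi>. ennreal (norm (G \<xi>)) \<partial>lborel)"
    unfolding C_def
  proof (rule nn_integral_mono)
    fix \<xi>
    have "(norm (G \<xi>))\<^sup>2 \<le> norm (G \<xi>)"
      unfolding power2_eq_square using bdd[of \<xi>] by (rule mult_left_le) simp
    then show "(ennreal (norm (G \<xi>)))\<^sup>2 \<le> ennreal (norm (G \<xi>))"
      unfolding ennreal_power[OF norm_ge_zero] by (rule ennreal_leI)
  qed
  also have "\<dots> < \<infinity>" using G by (simp add: integrable_iff_bounded)
  finally have C: "C < top" by simp
  let ?d = "\<lambda>R. (LINT \<xi>|lborel. truncated_fourier f R \<xi> * G \<xi>) - (LINT \<xi>|lborel. F \<xi> * G \<xi>)"
  have bound: "ennreal ((norm (?d R))\<^sup>2) \<le> C * (\<integral>\<^sup>+ \<xi>. ennreal ((norm (F \<xi> - truncated_fourier f R \<xi>))\<^sup>2) \<partial>lborel)" for R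
  proof -
    have diff: "?d R = (LINT \<xi>|lborel. truncated_fourier f R \<xi> * G \<xi> - F \<xi> * G \<xi>)"
      by (rule Bochner_Integration.integral_diff[symmetric, OF truncated_fourier_pairing(1)[OF f G] FG])
    have "ennreal (norm (?d R)) \<le> (\<integral>\<^sup>+ \<xi>. ennreal (norm (truncated_fourier f R \<xi> * G \<xi> - F \<xi> * G \<xi>)) \<partial>lborel)"
      unfolding diff
      by (rule integral_norm_bound_ennreal[OF Bochner_Integration.integrable_diff[OF truncated_fourier_pairing(1)[OF f G] FG]])
    also have "\<dots> = (\<integral>\<^sup>+ \<xi>. ennreal (norm (F \<xi> - truncated_fourier f R \<xi>)) * ennreal (norm (G \<xi>)) \<partial>lborel)"
    proof (rule nn_integral_cong)
      fix \<xi>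
      have "norm (truncated_fourier f R \<xi> * G \<xi> - F \<xi> * G \<xi>) = norm (F \<xi> - truncated_fourier f R \<xi>) * norm (G \<xi>)"
        by (metis left_diff_distrib norm_minus_commute norm_mult)
      then show "ennreal (norm (truncated_fourier f R \<xi> * G \<xi> - F \<xi> * G \<xi>)) =
          ennreal (norm (F \<xi> - truncated_fourier f R \<xi>)) * ennreal (norm (G \<xi>))"
        by (simp only: ennreal_mult[OF norm_ge_zero norm_ge_zero])
    qed
    finally have "(ennreal (norm (?d R)))\<^sup>2 \<le>
        (\<integral>\<^sup>+ \<xi>. ennreal (norm (F \<xi> - truncated_fourier f R \<xi>)) * ennreal (norm (G \<xi>)) \<partial>lborel)\<^sup>2"
      by (rule power_mono) (rule zero_le)
    also have "\<dots> \<le> (\<integral>\<^sup>+ \<xi>. (ennreal (norm (F \<xi> - truncated_fourier f R \<xi>)))\<^sup>2 \<partial>lborel) * C"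
      unfolding C_def by (rule Cauchy_Schwarz_nn_integral) measurable
    finally show ?thesis by (simp only: ennreal_power[OF norm_ge_zero] mult.commute[of _ C])
  qed
  have "((\<lambda>R. C * (\<integral>\<^sup>+ \<xi>. ennreal ((norm (F \<xi> - truncated_fourier f R \<xi>))\<^sup>2) \<partial>lborel)) \<longlongrightarrow> C * 0) at_top"
    by (rule ennreal_tendsto_cmult[OF C]) (use F in \<open>simp add: has_fourier_L2_def\<close>)
  then have lim0: "((\<lambda>R. C * (\<integral>\<^sup>+ \<xi>. ennreal ((norm (F \<xi> - truncated_fourier f R \<xi>))\<^sup>2) \<partial>lborel)) \<longlongrightarrow> 0) at_top"
    by simp
  have "((\<lambda>R. ennreal ((norm (?d R))\<^sup>2)) \<longlongrightarrow> ennreal 0) at_top"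
    unfolding ennreal_0
  proof (rule tendsto_sandwich[OF _ _ tendsto_const lim0])
    show "\<forall>\<^sub>F R in at_top. ennreal ((norm (?d R))\<^sup>2) \<le>
        C * (\<integral>\<^sup>+ \<xi>. ennreal ((norm (F \<xi> - truncated_fourier f R \<xi>))\<^sup>2) \<partial>lborel)"
      by (intro always_eventually allI bound)
  qed (intro always_eventually allI zero_le)
  then have "((\<lambda>R. (norm (?d R))\<^sup>2) \<longlongrightarrow> 0) at_top"
    by (rule tendsto_ennrealD) (intro always_eventually allI zero_le_power2 order_refl)+
  from tendsto_real_sqrt[OF this] have "((\<lambda>R. norm (?d R)) \<longlongrightarrow> 0) at_top" by simp
  then show ?thesis
    by (rule LIM_zero_cancel[OF tendsto_norm_zero_cancel])
qed

text \<open>The bound exp(-v) <= 1/v at v = u^2 / (2 \<sigma>^2). Its factor \<sigma>^2 against the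
  1/\<sigma> of the density leaves one power of \<sigma>, which makes the contribution far from the
  centre disappear in the limit.\<close>

lemma normal_density_tail_le:
  assumes "\<sigma> > 0" "u \<noteq> 0"
  shows "normal_density 0 \<sigma> u \<le> \<sigma> / u\<^sup>2"
proof -
  have v: "0 < u\<^sup>2 / (2 * \<sigma>\<^sup>2)" using assms by simp
  have "exp (- v) \<le> 1 / v" if "0 < v" for v :: real
  proof -
    have "v \<le> exp v" using exp_ge_add_one_self[of v] by linarith
    then show ?thesis
      unfolding exp_minus inverse_eq_divide using that by (intro divide_left_mono) auto
  qed
  from this[OF v] have "exp (- (u\<^sup>2 / (2 * \<sigma>\<^sup>2))) \<le> 2 * \<sigma>\<^sup>2 / u\<^sup>2" by simp
  moreover have "2 \<le> sqrt (2 * pi)"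
    using pi_gt3 by (intro real_le_rsqrt) simp
  moreover from \<open>2 \<le> sqrt (2 * pi)\<close> have "1 / (sqrt (2 * pi) * \<sigma>) \<le> 1 / (2 * \<sigma>)"
    using assms by (intro divide_left_mono mult_right_mono) auto
  ultimately have "1 / (sqrt (2 * pi) * \<sigma>) * exp (- (u\<^sup>2 / (2 * \<sigma>\<^sup>2))) \<le> 1 / (2 * \<sigma>) * (2 * \<sigma>\<^sup>2 / u\<^sup>2)"
    using assms by (intro mult_mono) simp_all
  also have "\<dots> = \<sigma> / u\<^sup>2" using assms by (simp add: power2_eq_square)
  finally show ?thesis using assms by (simp add: normal_density_def real_sqrt_mult)
qed

text \<open>Near \<open>x\<close> dominated convergence applies after rescaling; away from \<open>x\<close> the kernel is at most
  \<open>\<sigma> / (x - y)\<^sup>2\<close>, and \<open>\<bar>f\<bar> / (x - y)\<^sup>2\<close> is integrable there although \<open>f\<close> is only in \<open>L\<^sup>2\<close>.\<close>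

lemma normal_density_approximate_identity:
  assumes cont: "continuous_on UNIV f" and f: "square_integrable f"
  shows "\<And>n. integrable lborel (\<lambda>y. f y * normal_density 0 (1 / Suc n) (x - y))"
    and "(\<lambda>n. LINT y|lborel. f y * normal_density 0 (1 / Suc n) (x - y)) \<longlonglongrightarrow> f x"
proof -
  from f have [measurable]: "f \<in> borel_measurable lborel" by (simp add: square_integrable_def)
  define \<sigma> :: "nat \<Rightarrow> real" where "\<sigma> = (\<lambda>n. 1 / Suc n)"
  have \<sigma>: "0 < \<sigma> n" for n by (simp add: \<sigma>_def)
  have \<sigma>0: "\<sigma> \<longlonglongrightarrow> 0" unfolding \<sigma>_def using LIMSEQ_inverse_real_of_nat by (simp add: inverse_eq_divide)
  define f1 where "f1 = (\<lambda>y. indicator {x - 1..x + 1} y * f y)"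
  define f2 where "f2 = (\<lambda>y. f y - f1 y)"
  have [measurable]: "f1 \<in> borel_measurable lborel" "f2 \<in> borel_measurable lborel"
    unfolding f1_def f2_def by measurable
  have "bounded (f ` {x - 1..x + 1})"
    by (intro compact_imp_bounded compact_continuous_image continuous_on_subset[OF cont]) auto
  then obtain B where "\<forall>y\<in>{x - 1..x + 1}. \<bar>f y\<bar> \<le> B"
    by (auto simp: bounded_iff)
  then have B: "\<And>y. y \<in> {x - 1..x + 1} \<Longrightarrow> \<bar>f y\<bar> \<le> B" by blast
  have "0 \<le> B" using B[of x] by simp
  then have f1_bd: "\<bar>f1 y\<bar> \<le> B" for y using B by (simp add: f1_def indicator_def)
  define N where "N = (\<lambda>n y. normal_density 0 (\<sigma> n) (x - y))"
  have [measurable]: "N n \<in> borel_measurable lborel" for n unfolding N_def by measurable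
  have int_N: "integrable lborel (N n)" for n
    using lborel_integrable_real_affine[OF integrable_normal_density[OF \<sigma>[of n], of 0], of "-1" x] by (simp add: N_def)
  have int1: "integrable lborel (\<lambda>y. f1 y * N n y)" for n
  proof (rule Bochner_Integration.integrable_bound)
    show "integrable lborel (\<lambda>y. B * N n y)" using int_N by simp
    show "AE y in lborel. norm (f1 y * N n y) \<le> norm (B * N n y)"
      using f1_bd \<open>0 \<le> B\<close> by (intro AE_I2) (simp add: abs_mult mult_right_mono)
  qed measurable
  \<comment> \<open>With u = x - y and |u| > 1, this dominates the far part: |f| / u^2 <= f^2 +
    1/u^4 <= f^2 + 1/u^2 <= f^2 + 2 / (1 + u^2).\<close>
  define g where "g = (\<lambda>y. (f y)\<^sup>2 + 2 * (1 + (x + (-1) * y)\<^sup>2) powr (- 1))"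
  have int_g: "integrable lborel g"
  proof -
    have 1: "integrable lborel (\<lambda>y. (f y)\<^sup>2)" using f by (simp add: square_integrable_def)
    have 2: "integrable lborel (\<lambda>y. (1 + (x + (-1) * y)\<^sup>2) powr (- 1))"
      using lborel_integrable_real_affine[OF integrable_one_plus_square_powr[of 1], of "-1" x] by simp
    show ?thesis
      unfolding g_def by (rule Bochner_Integration.integrable_add[OF 1 integrable_mult_right[OF 2]])
  qed
  have bd2: "\<bar>f2 y * N n y\<bar> \<le> \<sigma> n * g y" for n y
  proof (cases "y \<in> {x - 1..x + 1}")
    case True
    then have "f2 y = 0" by (simp add: f2_def f1_def)
    moreover have "0 \<le> g y" unfolding g_def by (intro add_nonneg_nonneg mult_nonneg_nonneg) auto
    ultimately show ?thesis using \<sigma>[of n] by simp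
  next
    case False
    define u where "u = x - y"
    have u: "1 < \<bar>u\<bar>" using False unfolding u_def atLeastAtMost_iff by linarith
    then have "1 < u\<^sup>2" using one_less_power[OF u pos2] by simp
    have "\<bar>f2 y * N n y\<bar> = \<bar>f y\<bar> * normal_density 0 (\<sigma> n) u"
      using False by (simp add: f2_def f1_def N_def u_def abs_mult normal_density_nonneg)
    also have "\<dots> \<le> \<bar>f y\<bar> * (\<sigma> n / u\<^sup>2)"
      using u by (intro mult_left_mono normal_density_tail_le \<sigma>) auto
    also have "\<dots> = \<sigma> n * (\<bar>f y\<bar> * (1 / u\<^sup>2))" by simp
    finally have "\<bar>f2 y * N n y\<bar> \<le> \<sigma> n * (\<bar>f y\<bar> * (1 / u\<^sup>2))" .
    moreover have "\<bar>f y\<bar> * (1 / u\<^sup>2) \<le> g y"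
    proof -
      have ab: "a * b \<le> a\<^sup>2 + b\<^sup>2" if "0 \<le> a" "0 \<le> b" for a b :: real
        using sum_squares_bound[of a b] mult_nonneg_nonneg[OF that] by linarith
      have qq: "q\<^sup>2 \<le> q" if "0 \<le> q" "q \<le> 1" for q :: real
        using that by (simp add: power2_eq_square mult_left_le)
      have "1 / v \<le> 2 / (1 + v)" if "1 < v" for v :: real
        using that by (simp add: field_simps)
      from this[OF \<open>1 < u\<^sup>2\<close>] have "1 / u\<^sup>2 \<le> 2 / (1 + u\<^sup>2)" .
      moreover have "(1 / v)\<^sup>2 \<le> 1 / v" if "1 < v" for v :: real
        using that by (intro qq) (auto simp: divide_le_eq)
      from this[OF \<open>1 < u\<^sup>2\<close>] have "(1 / u\<^sup>2)\<^sup>2 \<le> 1 / u\<^sup>2" .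
      moreover have "\<bar>f y\<bar> * (1 / u\<^sup>2) \<le> (f y)\<^sup>2 + (1 / u\<^sup>2)\<^sup>2"
        using ab[of "\<bar>f y\<bar>" "1 / u\<^sup>2"] by simp
      moreover have "g y = (f y)\<^sup>2 + 2 / (1 + u\<^sup>2)"
      proof -
        have "0 < 1 + u\<^sup>2" by (simp add: add_pos_nonneg)
        then show ?thesis by (simp add: g_def u_def powr_minus divide_inverse)
      qed
      ultimately show ?thesis by linarith
    qed
    then have "\<sigma> n * (\<bar>f y\<bar> * (1 / u\<^sup>2)) \<le> \<sigma> n * g y"
      using \<sigma>[of n] by (intro mult_left_mono) auto
    ultimately show ?thesis by (rule order_trans)
  qed
  have int2: "integrable lborel (\<lambda>y. f2 y * N n y)" for n
  proof (rule Bochner_Integration.integrable_bound)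
    show "integrable lborel (\<lambda>y. \<sigma> n * g y)" using int_g by simp
    show "AE y in lborel. norm (f2 y * N n y) \<le> norm (\<sigma> n * g y)"
    proof (intro AE_I2)
      show "norm (f2 y * N n y) \<le> norm (\<sigma> n * g y)" for y using bd2[of y n] by simp
    qed
  qed measurable
  have split: "f y * N n y = f1 y * N n y + f2 y * N n y" for n y
    by (simp add: f2_def algebra_simps)
  show "integrable lborel (\<lambda>y. f y * normal_density 0 (1 / Suc n) (x - y))" for n
    using Bochner_Integration.integrable_add[OF int1[of n] int2[of n]] unfolding split[symmetric] by (simp add: N_def \<sigma>_def)
  have lim2: "(\<lambda>n. LINT y|lborel. f2 y * N n y) \<longlonglongrightarrow> 0"
  proof (rule tendsto_norm_zero_cancel, rule tendsto_sandwich[OF _ _ tendsto_const])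
    show "(\<lambda>n. \<sigma> n * (LINT y|lborel. g y)) \<longlonglongrightarrow> 0"
      by (rule tendsto_mult_left_zero[OF \<sigma>0])
    have "norm (LINT y|lborel. f2 y * N n y) \<le> (LINT y|lborel. \<sigma> n * g y)" for n
    proof (rule Bochner_Integration.integral_norm_bound_integral[OF int2])
      show "integrable lborel (\<lambda>y. \<sigma> n * g y)" using int_g by simp
      show "norm (f2 y * N n y) \<le> \<sigma> n * g y" for y using bd2[of y n] by simp
    qed
    then show "\<forall>\<^sub>F n in sequentially. norm (LINT y|lborel. f2 y * N n y) \<le> \<sigma> n * (LINT y|lborel. g y)"
      by simp
  qed simp
  have eq1: "(LINT y|lborel. f1 y * N n y) = (LINT z|lborel. f1 (x + \<sigma> n * z) * std_normal_density z)" for n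
  proof -
    have "(LINT y|lborel. f1 y * N n y) = \<bar>\<sigma> n\<bar> *\<^sub>R (LINT z|lborel. f1 (x + \<sigma> n * z) * N n (x + \<sigma> n * z))"
      by (rule lborel_integral_real_affine) (use \<sigma>[of n] in simp)
    also have "\<dots> = (LINT z|lborel. \<sigma> n * (f1 (x + \<sigma> n * z) * N n (x + \<sigma> n * z)))"
      unfolding integral_mult_right_zero using \<sigma>[of n] by simp
    also have "\<dots> = (LINT z|lborel. f1 (x + \<sigma> n * z) * std_normal_density z)"
    proof (rule Bochner_Integration.integral_cong[OF refl])
      fix z
      have "\<sigma> n * N n (x + \<sigma> n * z) = std_normal_density z"
        using \<sigma>[of n] unfolding N_def normal_density_def by (simp add: real_sqrt_mult power_mult_distrib)
      then show "\<sigma> n * (f1 (x + \<sigma> n * z) * N n (x + \<sigma> n * z)) = f1 (x + \<sigma> n * z) * std_normal_density z"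
        by (simp only: mult.left_commute[of "\<sigma> n"])
    qed
    finally show ?thesis .
  qed
  have "(\<lambda>n. LINT z|lborel. f1 (x + \<sigma> n * z) * std_normal_density z) \<longlonglongrightarrow> (LINT z|lborel. f x * std_normal_density z)"
  proof (rule integral_dominated_convergence)
    show "integrable lborel (\<lambda>z. B * std_normal_density z)" by simp
    show "AE z in lborel. (\<lambda>n. f1 (x + \<sigma> n * z) * std_normal_density z) \<longlonglongrightarrow> f x * std_normal_density z"
    proof (intro AE_I2)
      fix z
      have lim: "(\<lambda>n. x + \<sigma> n * z) \<longlonglongrightarrow> x"
        using tendsto_add[OF tendsto_const[of x] tendsto_mult_left_zero[OF \<sigma>0, of z]] by simp
      have "(\<lambda>n. f (x + \<sigma> n * z)) \<longlonglongrightarrow> f x"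
        by (rule continuous_on_tendsto_compose[OF cont lim]) auto
      moreover have "\<forall>\<^sub>F n in sequentially. f (x + \<sigma> n * z) = f1 (x + \<sigma> n * z)"
        using tendstoD[OF lim, of 1]
      proof (rule eventually_mono)
        fix n assume "dist (x + \<sigma> n * z) x < 1"
        then have "x + \<sigma> n * z \<in> {x - 1..x + 1}" unfolding dist_real_def atLeastAtMost_iff by linarith
        then show "f (x + \<sigma> n * z) = f1 (x + \<sigma> n * z)" unfolding f1_def by simp
      qed simp
      ultimately have "(\<lambda>n. f1 (x + \<sigma> n * z)) \<longlonglongrightarrow> f x"
        by (rule Lim_transform_eventually)
      then show "(\<lambda>n. f1 (x + \<sigma> n * z) * std_normal_density z) \<longlonglongrightarrow> f x * std_normal_density z"
        by (intro tendsto_mult tendsto_const)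
    qed
    show "AE z in lborel. norm (f1 (x + \<sigma> n * z) * std_normal_density z) \<le> B * std_normal_density z" for n
      unfolding real_norm_def abs_mult
      by (intro AE_I2 mult_mono f1_bd) (auto simp: normal_density_nonneg \<open>0 \<le> B\<close>)
  qed measurable
  then have "(\<lambda>n. LINT y|lborel. f1 y * N n y) \<longlonglongrightarrow> f x"
    unfolding eq1 by simp
  from tendsto_add[OF this lim2]
  have "(\<lambda>n. (LINT y|lborel. f1 y * N n y) + (LINT y|lborel. f2 y * N n y)) \<longlonglongrightarrow> f x" by simp
  moreover have "(LINT y|lborel. f1 y * N n y) + (LINT y|lborel. f2 y * N n y) = (LINT y|lborel. f y * N n y)" for n
    unfolding split by (rule Bochner_Integration.integral_add[symmetric, OF int1 int2])
  ultimately show "(\<lambda>n. LINT y|lborel. f y * normal_density 0 (1 / Suc n) (x - y)) \<longlonglongrightarrow> f x"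
    by (simp add: N_def \<sigma>_def)
qed

text \<open>The integral of \<open>F\<close> times the damped exponential \<open>G n\<close> is
  followed in two ways as the damping disappears. Domination by the norm of \<open>F\<close> leads
  to the inversion integral; moving the transform onto \<open>G n\<close> leads to f smoothed by a
  Gaussian of width \<open>1 / Suc n\<close>, which tends to f x because f is continuous.\<close>

lemma fourier_L2_inversion:
  assumes F: "has_fourier_L2 f F" and int_F: "integrable lborel F" and cont: "continuous_on UNIV f"
  shows "complex_of_real (f x) = complex_of_real (1 / sqrt (2 * pi)) * (LINT \<xi>|lborel. F \<xi> * cis (x * \<xi>))"
proof -
  note [measurable] = has_fourier_L2_measurable[OF F]
  have f: "square_integrable f" using F by (simp add: has_fourier_L2_def)
  define G where "G = (\<lambda>n \<xi>. complex_of_real (exp (- (1 / Suc n * \<xi>)\<^sup>2 / 2)) * cis (x * \<xi>))"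
  have [measurable]: "G n \<in> borel_measurable lborel" for n unfolding G_def by measurable
  have G_le: "norm (G n \<xi>) \<le> 1" for n \<xi> by (simp add: G_def norm_mult)
  have int_G: "integrable lborel (G n)" for n
    by (rule Bochner_Integration.integrable_bound[OF integrable_gaussian[of "1 / Suc n"]])
      (auto simp: G_def norm_mult)
  have int_FG: "integrable lborel (\<lambda>\<xi>. F \<xi> * G n \<xi>)" for n
    by (rule Bochner_Integration.integrable_bound[OF int_F])
      (use G_le[of n] in \<open>auto simp: norm_mult mult_left_le\<close>)
  have hat: "(LINT \<xi>|lborel. G n \<xi> * cis (- (y * \<xi>))) = complex_of_real (2 * pi * normal_density 0 (1 / Suc n) (x - y))" for n y
  proof -
    have "G n \<xi> * cis (- (y * \<xi>)) = complex_of_real (exp (- (1 / Suc n * \<xi>)\<^sup>2 / 2)) * cis ((x - y) * \<xi>)" for \<xi>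
      by (simp add: G_def mult.assoc cis_mult algebra_simps)
    then show ?thesis using fourier_gaussian[of "1 / Suc n" "x - y"] by simp
  qed
  have FG: "(LINT \<xi>|lborel. F \<xi> * G n \<xi>) = complex_of_real (sqrt (2 * pi)) *
      complex_of_real (LINT y|lborel. f y * normal_density 0 (1 / Suc n) (x - y))" for n
  proof -
    let ?N = "\<lambda>y. normal_density 0 (1 / Suc n) (x - y)"
    \<comment> \<open>The cutoff runs through natural numbers so that dominated convergence, a
      statement on sequences, can remove it on the other side of the pairing.\<close>
    have "(\<lambda>k. LINT \<xi>|lborel. truncated_fourier f (real k) \<xi> * G n \<xi>) \<longlonglongrightarrow> (LINT \<xi>|lborel. F \<xi> * G n \<xi>)"
      by (rule filterlim_compose[OF fourier_pairing_tendsto[OF F int_G G_le int_FG] filterlim_real_sequentially])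
    moreover have "(LINT \<xi>|lborel. truncated_fourier f R \<xi> * G n \<xi>) =
        complex_of_real (sqrt (2 * pi) * (LINT y|lborel. indicator {-R..R} y * (f y * ?N y)))" for R
    proof -
      have "q * L = 1 / q * (q * q * L)" if "q > 0" for q L :: real
        using that by simp
      from this[of "sqrt (2 * pi)"]
      have "sqrt (2 * pi) * (LINT y|lborel. indicator {-R..R} y * (f y * ?N y)) =
          1 / sqrt (2 * pi) * (2 * pi * (LINT y|lborel. indicator {-R..R} y * (f y * ?N y)))"
        by simp
      also have "2 * pi * (LINT y|lborel. indicator {-R..R} y * (f y * ?N y)) =
          (LINT y|lborel. indicator {-R..R} y * f y * (2 * pi * ?N y))"
        unfolding integral_mult_right_zero[symmetric] by (simp add: ac_simps)
      finally show ?thesis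
        unfolding truncated_fourier_pairing(2)[OF f int_G] hat
        by (simp add: of_real_mult[symmetric] del: of_real_mult of_real_divide)
    qed
    moreover have "(\<lambda>k. LINT y|lborel. indicator {- real k..real k} y * (f y * ?N y)) \<longlonglongrightarrow> (LINT y|lborel. f y * ?N y)"
    proof (rule integral_dominated_convergence)
      show "integrable lborel (\<lambda>y. norm (f y * ?N y))"
        using normal_density_approximate_identity(1)[OF cont f] by (rule integrable_norm)
      show "AE y in lborel. (\<lambda>k. indicator {- real k..real k} y * (f y * ?N y)) \<longlonglongrightarrow> f y * ?N y"
      proof (intro AE_I2 tendsto_eventually)
        fix y
        show "\<forall>\<^sub>F k in sequentially. indicator {- real k..real k} y * (f y * ?N y) = f y * ?N y"
          using eventually_ge_at_top[of "nat \<lceil>\<bar>y\<bar>\<rceil>"]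
        proof eventually_elim
          case (elim k)
          have "\<bar>y\<bar> \<le> real (nat \<lceil>\<bar>y\<bar>\<rceil>)" by (rule real_nat_ceiling_ge)
          also have "\<dots> \<le> real k" using elim by (simp only: of_nat_le_iff)
          finally have "y \<in> {- real k..real k}" by (simp add: abs_le_iff)
          then show ?case by simp
        qed
      qed
    qed (auto simp: indicator_def)
    ultimately show ?thesis
      by (intro LIMSEQ_unique) (auto intro!: tendsto_intros)
  qed
  have "(\<lambda>n. LINT \<xi>|lborel. F \<xi> * G n \<xi>) \<longlonglongrightarrow> (LINT \<xi>|lborel. F \<xi> * cis (x * \<xi>))"
  proof (rule integral_dominated_convergence)
    show "integrable lborel (\<lambda>\<xi>. norm (F \<xi>))" using int_F by simp
    show "AE \<xi> in lborel. (\<lambda>n. F \<xi> * G n \<xi>) \<longlonglongrightarrow> F \<xi> * cis (x * \<xi>)"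
    proof (intro AE_I2)
      fix \<xi>
      have "(\<lambda>n. complex_of_real (exp (- (1 / Suc n * \<xi>)\<^sup>2 / 2)) * cis (x * \<xi>)) \<longlonglongrightarrow>
          complex_of_real (exp (- (0 * \<xi>)\<^sup>2 / 2)) * cis (x * \<xi>)"
        using LIMSEQ_inverse_real_of_nat by (intro tendsto_intros) (auto simp: inverse_eq_divide)
      then show "(\<lambda>n. F \<xi> * G n \<xi>) \<longlonglongrightarrow> F \<xi> * cis (x * \<xi>)"
        unfolding G_def by (intro tendsto_mult tendsto_const) simp
    qed
    show "AE \<xi> in lborel. norm (F \<xi> * G n \<xi>) \<le> norm (F \<xi>)" for n
      using G_le[of n] by (auto simp: norm_mult mult_left_le)
  qed measurable
  moreover have "(\<lambda>n. LINT \<xi>|lborel. F \<xi> * G n \<xi>) \<longlonglongrightarrow> complex_of_real (sqrt (2 * pi)) * complex_of_real (f x)"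
    unfolding FG by (intro tendsto_intros normal_density_approximate_identity(2)[OF cont f])
  ultimately have "(LINT \<xi>|lborel. F \<xi> * cis (x * \<xi>)) = complex_of_real (sqrt (2 * pi)) * complex_of_real (f x)"
    by (rule LIMSEQ_unique)
  then show ?thesis by simp
qed

text \<open>A weighted Cauchy-Schwarz estimate, splitting the exponent as 1/2 = (1 - s)/2 + s/2. The
  weight of exponent 1/2 dominates both 1 and |\<xi>|, so a single bound controls the function and
  its derivative. The form a b <= \<mu> a^2 + b^2 / \<mu> with free \<mu> gives integrability at
  \<mu> = 1 and a bound linear in \<open>N\<close> for \<mu> close to \<open>N\<close>.\<close>

lemma sobolev_weighted_L1_bound:
  assumes s: "s > 3 / 2" and [measurable]: "F \<in> borel_measurable lborel"
    and F: "integrable lborel (\<lambda>\<xi>. (1 + \<xi>\<^sup>2) powr s * (norm (F \<xi>))\<^sup>2)"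
    and N: "N\<^sup>2 = (LINT \<xi>|lborel. (1 + \<xi>\<^sup>2) powr s * (norm (F \<xi>))\<^sup>2)" "0 \<le> N"
  shows "integrable lborel (\<lambda>\<xi>. (1 + \<xi>\<^sup>2) powr (1 / 2) * norm (F \<xi>))"
    and "(LINT \<xi>|lborel. (1 + \<xi>\<^sup>2) powr (1 / 2) * norm (F \<xi>)) \<le>
      ((LINT \<xi>|lborel. (1 + \<xi>\<^sup>2) powr (1 - s)) + 1) * N"
proof -
  define I where "I = (LINT \<xi>|lborel. (1 + \<xi>\<^sup>2) powr (1 / 2) * norm (F \<xi>))"
  define C where "C = (LINT \<xi>::real|lborel. (1 + \<xi>\<^sup>2) powr (1 - s))"
  have C_int: "integrable lborel (\<lambda>\<xi>::real. (1 + \<xi>\<^sup>2) powr (1 - s))"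
    using integrable_one_plus_square_powr[of "s - 1"] s by simp
  have "0 \<le> C" unfolding C_def by (rule Bochner_Integration.integral_nonneg) simp
  have pw: "(1 + \<xi>\<^sup>2) powr (1 / 2) * norm (F \<xi>) \<le>
      \<mu> * (1 + \<xi>\<^sup>2) powr (1 - s) + (1 + \<xi>\<^sup>2) powr s * (norm (F \<xi>))\<^sup>2 / \<mu>" if "\<mu> > 0" for \<mu> \<xi>
  proof -
    define a where "a = (1 + \<xi>\<^sup>2) powr ((1 - s) / 2)"
    define b where "b = (1 + \<xi>\<^sup>2) powr (s / 2) * norm (F \<xi>)"
    have "a * b = (1 + \<xi>\<^sup>2) powr ((1 - s) / 2 + s / 2) * norm (F \<xi>)"
      unfolding a_def b_def powr_add by (simp only: mult.assoc)
    moreover have "(1 - s) / 2 + s / 2 = 1 / 2" by (simp add: field_simps)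
    ultimately have ab: "a * b = (1 + \<xi>\<^sup>2) powr (1 / 2) * norm (F \<xi>)" "0 \<le> a * b"
      by (simp_all add: a_def b_def)
    have sq: "(z powr (p / 2))\<^sup>2 = z powr p" for z p :: real
      by (simp add: power2_eq_square powr_add[symmetric])
    have a2: "a\<^sup>2 = (1 + \<xi>\<^sup>2) powr (1 - s)" and b2: "b\<^sup>2 = (1 + \<xi>\<^sup>2) powr s * (norm (F \<xi>))\<^sup>2"
      unfolding a_def b_def power_mult_distrib sq by (rule refl)+
    have "0 \<le> (\<mu> * a - b)\<^sup>2" by simp
    then have "2 * (\<mu> * (a * b)) \<le> \<mu> * (\<mu> * a\<^sup>2) + b\<^sup>2"
      by (simp add: power2_eq_square algebra_simps)
    moreover have "0 \<le> \<mu> * (a * b)" using ab(2) that by simp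
    ultimately have "\<mu> * (a * b) \<le> \<mu> * (\<mu> * a\<^sup>2) + b\<^sup>2" by linarith
    also have "\<dots> = \<mu> * (\<mu> * a\<^sup>2 + b\<^sup>2 / \<mu>)" using that by (simp add: distrib_left)
    finally have "a * b \<le> \<mu> * a\<^sup>2 + b\<^sup>2 / \<mu>" using that by (simp only: mult_le_cancel_left_pos)
    then show ?thesis unfolding ab(1) a2 b2 .
  qed
  have rhs: "integrable lborel (\<lambda>\<xi>. \<mu> * (1 + \<xi>\<^sup>2) powr (1 - s) + (1 + \<xi>\<^sup>2) powr s * (norm (F \<xi>))\<^sup>2 / \<mu>)" for \<mu>
    by (rule Bochner_Integration.integrable_add[OF integrable_mult_right[OF C_int] integrable_divide[OF F]])
  show int: "integrable lborel (\<lambda>\<xi>. (1 + \<xi>\<^sup>2) powr (1 / 2) * norm (F \<xi>))"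
  proof (rule Bochner_Integration.integrable_bound[OF rhs[of 1]])
    show "AE \<xi> in lborel. norm ((1 + \<xi>\<^sup>2) powr (1 / 2) * norm (F \<xi>)) \<le>
        norm (1 * (1 + \<xi>\<^sup>2) powr (1 - s) + (1 + \<xi>\<^sup>2) powr s * (norm (F \<xi>))\<^sup>2 / 1)"
    proof (intro AE_I2)
      show "norm ((1 + \<xi>\<^sup>2) powr (1 / 2) * norm (F \<xi>)) \<le>
        norm (1 * (1 + \<xi>\<^sup>2) powr (1 - s) + (1 + \<xi>\<^sup>2) powr s * (norm (F \<xi>))\<^sup>2 / 1)" for \<xi>
        using pw[of 1 \<xi>] by simp
    qed
  qed measurable
  have "I \<le> \<mu> * C + N\<^sup>2 / \<mu>" if "\<mu> > 0" for \<mu>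
  proof -
    have "I \<le> (LINT \<xi>|lborel. \<mu> * (1 + \<xi>\<^sup>2) powr (1 - s) + (1 + \<xi>\<^sup>2) powr s * (norm (F \<xi>))\<^sup>2 / \<mu>)"
      unfolding I_def by (intro integral_mono int rhs pw that)
    also have "\<dots> = \<mu> * C + N\<^sup>2 / \<mu>"
      unfolding C_def N using C_int F by simp
    finally show ?thesis .
  qed
  note I = this
  \<comment> \<open>The natural choice \<mu> = N fails for N = 0, so \<mu> = N + \<eta> is used;
    \<eta> = e / (C + 1) makes the total error exactly e.\<close>
  have "I \<le> (C + 1) * N"
  proof (rule field_le_epsilon)
    fix e :: real assume "e > 0"
    define \<eta> where "\<eta> = e / (C + 1)"
    have \<eta>: "\<eta> > 0" "(C + 1) * \<eta> = e" using \<open>0 \<le> C\<close> \<open>e > 0\<close> by (auto simp: \<eta>_def)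
    have "N\<^sup>2 \<le> (N + \<eta>) * (N + \<eta>)" using N(2) \<eta> by (simp add: power2_eq_square mult_mono)
    then have "N\<^sup>2 / (N + \<eta>) \<le> N + \<eta>" using N(2) \<eta> by (simp add: divide_le_eq)
    with I[of "N + \<eta>"] N(2) \<eta> have "I \<le> (N + \<eta>) * C + (N + \<eta>)" by simp
    also have "\<dots> = (C + 1) * N + (C + 1) * \<eta>" by (simp add: algebra_simps)
    finally show "I \<le> (C + 1) * N + e" using \<eta> by simp
  qed
  then show "(LINT \<xi>|lborel. (1 + \<xi>\<^sup>2) powr (1 / 2) * norm (F \<xi>)) \<le>
      ((LINT \<xi>|lborel. (1 + \<xi>\<^sup>2) powr (1 - s)) + 1) * N"
    by (simp add: I_def C_def)
qed

theorem sobolev_C1_embedding: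
  assumes s: "s > 3 / 2"
  obtains C where "0 \<le> C"
    "\<And>f x. f \<in> sobolev_cont s \<Longrightarrow> (f has_real_derivative deriv f x) (at x)"
    "\<And>f. f \<in> sobolev_cont s \<Longrightarrow> continuous_on UNIV (deriv f)"
    "\<And>f x. f \<in> sobolev_cont s \<Longrightarrow> \<bar>f x\<bar> \<le> C * sobolev_norm s f"
    "\<And>f x. f \<in> sobolev_cont s \<Longrightarrow> \<bar>deriv f x\<bar> \<le> C * sobolev_norm s f"
proof -
  \<comment> \<open>The constant of the weighted L1 bound; the factor 1 / sqrt(2 pi) of the
    inversion formula is at most 1 and is absorbed.\<close>
  define C where "C = (LINT \<xi>::real|lborel. (1 + \<xi>\<^sup>2) powr (1 - s)) + 1"
  have "0 \<le> C" unfolding C_def by (intro add_nonneg_nonneg Bochner_Integration.integral_nonneg) auto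
  have main: "(\<forall>x. (f has_real_derivative deriv f x) (at x)) \<and> continuous_on UNIV (deriv f) \<and>
    (\<forall>x. \<bar>f x\<bar> \<le> C * sobolev_norm s f) \<and> (\<forall>x. \<bar>deriv f x\<bar> \<le> C * sobolev_norm s f)"
    if f: "f \<in> sobolev_cont s" for f
  proof -
    have "f \<in> sobolev s" and cont: "continuous_on UNIV f" using f by (auto simp: sobolev_cont_def)
    from sobolev_fourier[OF this(1)] obtain F where F: "has_fourier_L2 f F"
      "integrable lborel (\<lambda>\<xi>. (1 + \<xi>\<^sup>2) powr s * (norm (F \<xi>))\<^sup>2)"
      "(sobolev_norm s f)\<^sup>2 = (LINT \<xi>|lborel. (1 + \<xi>\<^sup>2) powr s * (norm (F \<xi>))\<^sup>2)" "0 \<le> sobolev_norm s f" .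
    note [measurable] = has_fourier_L2_measurable[OF F(1)]
    define g where "g = (\<lambda>\<xi>. (1 + \<xi>\<^sup>2) powr (1 / 2) * norm (F \<xi>))"
    have g: "integrable lborel g" and g_le: "(LINT \<xi>|lborel. g \<xi>) \<le> C * sobolev_norm s f"
      unfolding g_def C_def
      using sobolev_weighted_L1_bound[OF s has_fourier_L2_measurable(2)[OF F(1)] F(2,3,4)] by auto
    have sq: "(1 + \<xi>\<^sup>2) powr (1 / 2) = sqrt (1 + \<xi>\<^sup>2)" for \<xi> :: real
      by (simp add: powr_half_sqrt)
    have F_g: "norm (F \<xi>) \<le> g \<xi>" for \<xi>
      unfolding g_def sq by (simp add: mult_le_cancel_right1)
    have xF_g: "\<bar>\<xi>\<bar> * norm (F \<xi>) \<le> g \<xi>" for \<xi>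
      unfolding g_def sq by (intro mult_right_mono real_le_rsqrt) auto
    have int_F: "integrable lborel F"
    proof (rule Bochner_Integration.integrable_bound[OF g])
      show "AE \<xi> in lborel. norm (F \<xi>) \<le> norm (g \<xi>)"
        by (intro AE_I2) (metis F_g abs_ge_self order_trans real_norm_def)
    qed measurable
    define c where "c = 1 / sqrt (2 * pi)"
    have c: "0 \<le> c" "c \<le> 1"
    proof -
      have "1 \<le> sqrt (2 * pi)" using pi_gt3 by (intro real_le_rsqrt) simp
      then show "0 \<le> c" "c \<le> 1" by (auto simp: c_def divide_le_eq)
    qed
    \<comment> \<open>The real part of the integrand in the inversion formula, which loses nothing
      as f is real. In this form it is differentiated as a real function of x; the derivative costs
      one factor |\<xi>|, which \<open>g\<close> still dominates.\<close>
    define k where "k = (\<lambda>x \<xi>. Re (F \<xi>) * cos (x * \<xi>) - Im (F \<xi>) * sin (x * \<xi>))"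
    define k' where "k' = (\<lambda>x \<xi>. - (\<xi> * (Re (F \<xi>) * sin (x * \<xi>) + Im (F \<xi>) * cos (x * \<xi>))))"
    have k_Re: "k x \<xi> = Re (F \<xi> * cis (x * \<xi>))" for x \<xi> by (simp add: k_def)
    have k'_Im: "k' x \<xi> = - (\<xi> * Im (F \<xi> * cis (x * \<xi>)))" for x \<xi> by (simp add: k'_def)
    have k_bd: "\<bar>k x \<xi>\<bar> \<le> g \<xi>" for x \<xi>
      using abs_Re_le_cmod[of "F \<xi> * cis (x * \<xi>)"] F_g[of \<xi>] by (simp add: k_Re norm_mult)
    have k'_bd: "\<bar>k' x \<xi>\<bar> \<le> g \<xi>" for x \<xi>
    proof -
      have "\<bar>k' x \<xi>\<bar> \<le> \<bar>\<xi>\<bar> * norm (F \<xi>)"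
        using mult_left_mono[OF abs_Im_le_cmod[of "F \<xi> * cis (x * \<xi>)"], of "\<bar>\<xi>\<bar>"]
        unfolding k'_Im by (simp only: abs_minus_cancel abs_mult norm_mult norm_cis mult_1_right abs_ge_zero)
      with xF_g[of \<xi>] show ?thesis by linarith
    qed
    have k_meas: "k x \<in> borel_measurable lborel" "k' x \<in> borel_measurable lborel" for x
      unfolding k_def k'_def by measurable
    have k_int: "integrable lborel (k x)" for x
    proof (rule Bochner_Integration.integrable_bound[OF g k_meas(1)])
      show "AE \<xi> in lborel. norm (k x \<xi>) \<le> norm (g \<xi>)"
        by (intro AE_I2) (metis k_bd abs_ge_self order_trans real_norm_def)
    qed
    have k'_int: "integrable lborel (k' x)" for x
    proof (rule Bochner_Integration.integrable_bound[OF g k_meas(2)])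
      show "AE \<xi> in lborel. norm (k' x \<xi>) \<le> norm (g \<xi>)"
        by (intro AE_I2) (metis k'_bd abs_ge_self order_trans real_norm_def)
    qed
    have k_deriv: "((\<lambda>x. k x \<xi>) has_real_derivative k' x \<xi>) (at x)" for x \<xi>
      unfolding k_def k'_def by (auto intro!: derivative_eq_intros simp: algebra_simps)
    have k'_cont: "continuous_on UNIV (\<lambda>x. k' x \<xi>)" for \<xi>
      unfolding k'_def by (intro continuous_intros)
    have f_eq: "f x = c * (LINT \<xi>|lborel. k x \<xi>)" for x
    proof -
      have int: "integrable lborel (\<lambda>\<xi>. F \<xi> * cis (x * \<xi>))"
        by (rule Bochner_Integration.integrable_bound[OF int_F]) (auto simp: norm_mult)
      have "f x = Re (complex_of_real c * (LINT \<xi>|lborel. F \<xi> * cis (x * \<xi>)))"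
        using fourier_L2_inversion[OF F(1) int_F cont, of x] unfolding c_def by (metis Re_complex_of_real)
      also have "\<dots> = c * Re (LINT \<xi>|lborel. F \<xi> * cis (x * \<xi>))" by simp
      also have "Re (LINT \<xi>|lborel. F \<xi> * cis (x * \<xi>)) = (LINT \<xi>|lborel. k x \<xi>)"
        unfolding k_Re by (rule integral_Re[symmetric, OF int])
      finally show ?thesis .
    qed
    have f': "(f has_real_derivative c * (LINT \<xi>|lborel. k' x \<xi>)) (at x)" for x
      unfolding f_eq[abs_def] by (intro DERIV_cmult DERIV_LINT[OF k_int k_meas(2) k_deriv k'_bd g])
    then have f'_eq: "deriv f x = c * (LINT \<xi>|lborel. k' x \<xi>)" for x by (rule DERIV_imp_deriv)
    have cI: "\<bar>c * (LINT \<xi>|lborel. h \<xi>)\<bar> \<le> C * sobolev_norm s f"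
      if "integrable lborel h" "\<And>\<xi>. \<bar>h \<xi>\<bar> \<le> g \<xi>" for h
    proof -
      have "norm (LINT \<xi>|lborel. h \<xi>) \<le> (LINT \<xi>|lborel. g \<xi>)"
        by (rule Bochner_Integration.integral_norm_bound_integral) (use that g in auto)
      then have "c * \<bar>LINT \<xi>|lborel. h \<xi>\<bar> \<le> 1 * (C * sobolev_norm s f)"
        using c g_le by (intro mult_mono) auto
      then show ?thesis using c by (simp add: abs_mult)
    qed
    show ?thesis
    proof (intro conjI allI)
      show "(f has_real_derivative deriv f x) (at x)" for x using f'[of x] by (simp only: f'_eq)
      have "deriv f = (\<lambda>x. c * (LINT \<xi>|lborel. k' x \<xi>))" by (intro ext f'_eq)
      then show "continuous_on UNIV (deriv f)"
        using continuous_on_mult[OF continuous_on_const continuous_on_LINT[OF k_meas(2) k'_cont k'_bd g], of c]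
        by simp
      show "\<bar>f x\<bar> \<le> C * sobolev_norm s f" for x unfolding f_eq[of x] by (rule cI[OF k_int k_bd])
      show "\<bar>deriv f x\<bar> \<le> C * sobolev_norm s f" for x unfolding f'_eq[of x] by (rule cI[OF k'_int k'_bd])
    qed
  qed
  show thesis
    by (rule that[OF \<open>0 \<le> C\<close>]) (use main in blast)+
qed

section \<open>Smooth step functions\<close>

text \<open>The family is closed under differentiation, so that \<open>exp (- 1 / x)\<close> is smooth at \<open>0\<close>.\<close>

definition flat :: "real poly \<Rightarrow> real \<Rightarrow> real" where
  "flat p x = (if 0 < x then poly p (1 / x) * exp (- (1 / x)) else 0)"

lemma poly_mult_exp_tendsto_0: "((\<lambda>y. poly p y * exp (- y)) \<longlongrightarrow> (0::real)) at_top"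
proof -
  have "((\<lambda>y. \<Sum>i\<le>degree p. coeff p i * (y ^ i / exp y)) \<longlongrightarrow> (\<Sum>i\<le>degree p. coeff p i * 0)) at_top"
    by (intro tendsto_sum tendsto_mult tendsto_const tendsto_power_div_exp_0)
  then show ?thesis
    by (simp add: poly_altdef exp_minus field_simps sum_divide_distrib)
qed

text \<open>With y = 1/x, differentiation produces the factor y^2, which is the polynomial
  \<open>[:0, 0, 1:]\<close>, and replaces p by p - p'. At 0 the right difference quotient is y p(y)
  exp(-y) for y tending to infinity, hence tends to 0.\<close>

lemma DERIV_flat:
  "(flat p has_real_derivative flat ([:0, 0, 1:] * (p - pderiv p)) x) (at x)"
proof -
  consider "x > 0" | "x < 0" | "x = 0" by linarith
  then show ?thesis
  proof cases
    case 1
    have "((\<lambda>x. poly p (1 / x)) has_real_derivative poly (pderiv p) (1 / x) * - (1 / x\<^sup>2)) (at x)"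
      by (rule DERIV_chain'[OF _ poly_DERIV])
        (use 1 in \<open>auto intro!: derivative_eq_intros simp: power2_eq_square\<close>)
    moreover have "((\<lambda>x. exp (- (1 / x))) has_real_derivative exp (- (1 / x)) * (1 / x\<^sup>2)) (at x)"
      using 1 by (auto intro!: derivative_eq_intros simp: power2_eq_square)
    ultimately have "((\<lambda>x. poly p (1 / x) * exp (- (1 / x))) has_real_derivative
        poly p (1 / x) * (exp (- (1 / x)) * (1 / x\<^sup>2)) +
        poly (pderiv p) (1 / x) * - (1 / x\<^sup>2) * exp (- (1 / x))) (at x)"
      by (rule DERIV_mult[THEN DERIV_cong]) (simp add: algebra_simps)
    also have "poly p (1 / x) * (exp (- (1 / x)) * (1 / x\<^sup>2)) +
        poly (pderiv p) (1 / x) * - (1 / x\<^sup>2) * exp (- (1 / x))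
      = flat ([:0, 0, 1:] * (p - pderiv p)) x"
      using 1 by (simp add: flat_def power2_eq_square algebra_simps)
    finally have "((\<lambda>x. poly p (1 / x) * exp (- (1 / x))) has_real_derivative
        flat ([:0, 0, 1:] * (p - pderiv p)) x) (at x)" .
    then show ?thesis
      by (rule has_field_derivative_transform_within_open[OF _ open_greaterThan[of 0]])
        (use 1 in \<open>auto simp: flat_def\<close>)
  next
    case 2
    have "((\<lambda>x. 0) has_real_derivative flat ([:0, 0, 1:] * (p - pderiv p)) x) (at x)"
      using 2 by (simp add: flat_def)
    then show ?thesis
      by (rule has_field_derivative_transform_within_open[OF _ open_lessThan[of 0]])
        (use 2 in \<open>auto simp: flat_def\<close>)
  next
    case 3
    have "((\<lambda>h. poly ([:0, 1:] * p) (inverse h) * exp (- inverse h)) \<longlongrightarrow> 0) (at_right 0)"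
      by (rule filterlim_compose[OF poly_mult_exp_tendsto_0 filterlim_inverse_at_top_right])
    then have r: "((\<lambda>h. flat p h / h) \<longlongrightarrow> 0) (at_right 0)"
      by (rule tendsto_cong[THEN iffD1, rotated])
        (auto simp: eventually_at_filter flat_def field_simps)
    have l: "((\<lambda>h. flat p h / h) \<longlongrightarrow> 0) (at_left 0)"
      by (rule tendsto_eventually) (auto simp: eventually_at_filter flat_def)
    have "((\<lambda>h. flat p h / h) \<longlongrightarrow> 0) (at 0)"
      using l r by (simp add: filterlim_at_split)
    then show ?thesis
      using 3 by (simp add: DERIV_def flat_def)
  qed
qed

text \<open>Finite order of differentiability with an unnamed derivative: closure under sums,
  products and affine substitution becomes a one-step induction, and no formula for higher
  derivatives is ever needed.\<close>

primrec ndiff :: "nat \<Rightarrow> (real \<Rightarrow> real) \<Rightarrow> bool" where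
  "ndiff 0 f \<longleftrightarrow> True"
| "ndiff (Suc n) f \<longleftrightarrow> (\<exists>f'. (\<forall>x. (f has_real_derivative f' x) (at x)) \<and> ndiff n f')"

lemma ndiff_flat: "ndiff n (flat p)"
  by (induction n arbitrary: p) (auto intro!: exI DERIV_flat)

lemma ndiff_Suc_imp: "ndiff (Suc n) f \<Longrightarrow> ndiff n f"
  by (induction n arbitrary: f) (simp, metis ndiff.simps(2))

lemma ndiff_add: "ndiff n f \<Longrightarrow> ndiff n g \<Longrightarrow> ndiff n (\<lambda>x. f x + g x)"
proof (induction n arbitrary: f g)
  case (Suc n)
  then obtain f' g' where "\<And>x. (f has_real_derivative f' x) (at x)" "ndiff n f'"
    "\<And>x. (g has_real_derivative g' x) (at x)" "ndiff n g'" by auto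
  then show ?case
    using Suc.IH[of f' g'] by (auto intro!: exI[of _ "\<lambda>x. f' x + g' x"] derivative_eq_intros)
qed simp

lemma ndiff_mult: "ndiff n f \<Longrightarrow> ndiff n g \<Longrightarrow> ndiff n (\<lambda>x. f x * g x)"
proof (induction n arbitrary: f g)
  case (Suc n)
  then obtain f' g' where *: "\<And>x. (f has_real_derivative f' x) (at x)" "ndiff n f'"
    "\<And>x. (g has_real_derivative g' x) (at x)" "ndiff n g'" by auto
  have "ndiff n (\<lambda>x. f' x * g x + f x * g' x)"
    using * Suc.prems by (intro ndiff_add Suc.IH) (auto dest: ndiff_Suc_imp simp del: ndiff.simps)
  then show ?case
    using * by (auto intro!: exI[of _ "\<lambda>x. f' x * g x + f x * g' x"] derivative_eq_intros)
qed simp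

lemma ndiff_const: "ndiff n (\<lambda>x. c)"
  by (induction n arbitrary: c) (auto intro!: exI[of _ "\<lambda>x. 0"])

lemma ndiff_affine: "ndiff n f \<Longrightarrow> ndiff n (\<lambda>x. f (a + b * x))"
proof (induction n arbitrary: f)
  case (Suc n)
  then obtain f' where *: "\<And>x. (f has_real_derivative f' x) (at x)" "ndiff n f'" by auto
  have "((\<lambda>x. f (a + b * x)) has_real_derivative f' (a + b * x) * b) (at x)" for x
    by (rule DERIV_chain'[OF _ *(1)]) (auto intro!: derivative_eq_intros)
  then have "((\<lambda>x. f (a + b * x)) has_real_derivative b * f' (a + b * x)) (at x)" for x
    by (simp only: mult.commute[of b "f' _"])
  moreover have "ndiff n (\<lambda>x. b * f' (a + b * x))"
    by (intro ndiff_mult ndiff_const Suc.IH *)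
  ultimately show ?case by (auto intro!: exI[of _ "\<lambda>x. b * f' (a + b * x)"])
qed simp

text \<open>Derivatives are unique, so the witnesses for different orders fit together into the
  iterates of \<open>deriv\<close>. An indexed family of this kind is what
  \<open>test_function\<close> asks for.\<close>

lemma ndiff_family:
  assumes "\<And>n. ndiff n f"
  obtains D where "D 0 = f" "\<And>n x. (D n has_real_derivative D (Suc n) x) (at x)"
proof
  have *: "ndiff m ((deriv ^^ n) f)" for n m
  proof (induction n arbitrary: m)
    case (Suc n)
    from Suc[of "Suc m"] obtain g where g: "\<And>x. ((deriv ^^ n) f has_real_derivative g x) (at x)"
      "ndiff m g" by auto
    have "deriv ((deriv ^^ n) f) = g"
      using g(1) by (intro ext DERIV_imp_deriv)
    then show ?case using g(2) by simp
  qed (use assms in simp)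
  show "((deriv ^^ n) f has_real_derivative (deriv ^^ Suc n) f x) (at x)" for n x
  proof -
    from *[of "Suc 0" n] obtain g where g: "\<And>x. ((deriv ^^ n) f has_real_derivative g x) (at x)"
      by auto
    show ?thesis using g[of x] DERIV_imp_deriv[OF g, of x] by simp
  qed
qed simp

text \<open>The normalised antiderivative of a bump that is positive exactly on (-\<epsilon>,
  \<epsilon>). One family serves both ends: \<open>D 0\<close> is a smooth step for cutoffs in time,
  \<open>D 1\<close> a mollifier of integral 1. That \<open>D 1\<close> vanishes also at the points
  -\<epsilon> and \<epsilon> removes boundary terms later; for the higher derivatives the inequality
  is strict, since they are obtained by differentiating zero on an open set.\<close>

lemma smooth_step:
  fixes \<epsilon> :: real
  assumes "\<epsilon> > 0"
  obtains D :: "nat \<Rightarrow> real \<Rightarrow> real" where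
    "\<And>n x. (D n has_real_derivative D (Suc n) x) (at x)"
    "\<And>x. x \<le> - \<epsilon> \<Longrightarrow> D 0 x = 0" "\<And>x. \<epsilon> \<le> x \<Longrightarrow> D 0 x = 1"
    "\<And>x. 0 \<le> D 0 x" "\<And>x. D 0 x \<le> 1"
    "\<And>x. 0 \<le> D 1 x" "\<And>x. \<epsilon> \<le> \<bar>x\<bar> \<Longrightarrow> D 1 x = 0"
    "\<And>n x. \<epsilon> < \<bar>x\<bar> \<Longrightarrow> D (Suc n) x = 0"
proof -
  define \<eta> where "\<eta> = (\<lambda>x. flat 1 (\<epsilon> + 1 * x) * flat 1 (\<epsilon> + (-1) * x))"
  have nd: "ndiff n \<eta>" for n
    unfolding \<eta>_def by (intro ndiff_mult ndiff_affine ndiff_flat)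
  have "ndiff 1 \<eta>" by (rule nd)
  then have cont: "isCont \<eta> x" for x
    by (auto intro: DERIV_isCont)
  have \<eta>: "\<eta> x \<ge> 0" "\<epsilon> \<le> \<bar>x\<bar> \<Longrightarrow> \<eta> x = 0" "\<eta> 0 > 0" for x
    using assms by (auto simp: \<eta>_def flat_def)
  have "\<exists>F. \<forall>x::real. -\<infinity> < ereal x \<longrightarrow> ereal x < \<infinity> \<longrightarrow> (F has_vector_derivative \<eta> x) (at x)"
    by (rule einterval_antiderivative) (simp_all add: cont)
  then obtain F where "\<forall>x. (F has_vector_derivative \<eta> x) (at x)" by auto
  then have F: "(F has_real_derivative \<eta> x) (at x)" for x
    by (simp add: has_real_derivative_iff_has_vector_derivative)
  have mono: "F x \<le> F y" if "x \<le> y" for x y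
    by (rule DERIV_nonneg_imp_nondecreasing[OF that]) (meson F \<eta>(1))
  have contF: "continuous_on S F" for S
    using F by (auto intro!: continuous_at_imp_continuous_on DERIV_isCont)
  have F0: "(F has_real_derivative 0) (at x)" if "\<epsilon> \<le> \<bar>x\<bar>" for x
    using F[of x] \<eta>(2)[OF that] by simp
  have left: "F x = F (- \<epsilon>)" if "x \<le> - \<epsilon>" for x
  proof (cases "x = - \<epsilon>")
    case False
    have "F (- \<epsilon>) = F x"
      by (rule DERIV_isconst2[of x "-\<epsilon>", OF _ contF F0]) (use that False in auto)
    then show ?thesis ..
  qed simp
  have right: "F x = F \<epsilon>" if "\<epsilon> \<le> x" for x
  proof (cases "x = \<epsilon>")
    case False
    show ?thesis
      by (rule DERIV_isconst2[of \<epsilon> x, OF _ contF F0]) (use that False in auto)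
  qed simp
  \<comment> \<open>\<open>F\<close> is nondecreasing, so strict growth to the right of the single
    point 0 already makes the normalising denominator positive.\<close>
  have pos: "F (-\<epsilon>) < F \<epsilon>"
  proof -
    obtain d where "d > 0" "\<And>h. h > 0 \<Longrightarrow> h < d \<Longrightarrow> F 0 < F (0 + h)"
      using DERIV_pos_inc_right[OF F \<eta>(3)] by blast
    then have "F 0 < F (0 + min (d / 2) \<epsilon>)" using assms by auto
    also have "\<dots> \<le> F \<epsilon>" by (rule mono) simp
    finally show ?thesis using mono[of "-\<epsilon>" 0] assms by simp
  qed
  define J where "J = (\<lambda>x. (F x - F (-\<epsilon>)) / (F \<epsilon> - F (-\<epsilon>)))"
  define c where "c = 1 / (F \<epsilon> - F (-\<epsilon>))"
  have J': "(J has_real_derivative c * \<eta> x) (at x)" for x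
    unfolding J_def c_def using pos by (auto intro!: derivative_eq_intros F)
  have "ndiff n J" for n
    by (cases n) (auto intro!: exI[of _ "\<lambda>x. c * \<eta> x"] J' ndiff_mult nd ndiff_const)
  then obtain D where D: "D 0 = J" "\<And>n x. (D n has_real_derivative D (Suc n) x) (at x)"
    using ndiff_family by blast
  have D1: "D 1 x = c * \<eta> x" for x
    using DERIV_unique[OF D(2)[of 0] J'[folded D(1)]] by simp
  have J01: "0 \<le> J x" "J x \<le> 1" for x
  proof -
    have "F (-\<epsilon>) \<le> F x" by (metis left mono linear order_refl)
    moreover have "F x \<le> F \<epsilon>" by (metis right mono linear order_refl)
    ultimately show "0 \<le> J x" "J x \<le> 1" using pos by (auto simp: J_def field_simps)
  qed
  show thesis
  proof (rule that[of D, OF D(2)])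
    show "0 \<le> D 0 x" "D 0 x \<le> 1" for x using J01[of x] by (auto simp: D)
    show "D (Suc n) x = 0" if "\<epsilon> < \<bar>x\<bar>" for n x
      using that
    proof (induction n arbitrary: x)
      case 0
      then show ?case using \<eta>(2)[of x] D1[of x] by simp
    next
      case (Suc n)
      have "open {x. \<epsilon> < \<bar>x\<bar>}" by (intro open_Collect_less continuous_intros)
      then have "(D (Suc n) has_real_derivative 0) (at x)"
      proof (rule has_field_derivative_transform_within_open[OF DERIV_const])
        show "x \<in> {x. \<epsilon> < \<bar>x\<bar>}" using Suc.prems by simp
        show "0 = D (Suc n) z" if "z \<in> {x. \<epsilon> < \<bar>x\<bar>}" for z
          using Suc.IH[of z] that by simp
      qed
      from DERIV_unique[OF D(2) this] show ?case .
    qed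
    show "D 0 x = 0" if "x \<le> -\<epsilon>" for x using left[OF that] by (simp add: D J_def)
    show "D 0 x = 1" if "\<epsilon> \<le> x" for x using right[OF that] pos by (simp add: D J_def)
    show "0 \<le> D 1 x" for x unfolding D1 c_def using pos \<eta>(1)[of x] by simp
    show "D 1 x = 0" if "\<epsilon> \<le> \<bar>x\<bar>" for x unfolding D1 using \<eta>(2)[OF that] by simp
  qed
qed

section \<open>The continuity equation\<close>

text \<open>Testing with the product of a smoothed indicator of \<open>{t1..t2}\<close> and a mollifier at \<open>y\<close>.\<close>

lemma weak_conservation_law_pointwise:
  assumes weak: "weak_equation T r (\<lambda>t x. 1) g (\<lambda>t x. 0)"
    and cont_r: "continuous_on (time_interval T \<times> UNIV) (\<lambda>(t, x). r t x)"
    and cont_h: "continuous_on (time_interval T \<times> UNIV) (\<lambda>(t, x). h t x)"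
    and g': "\<And>t x. t \<in> time_interval T \<Longrightarrow> (g t has_real_derivative h t x) (at x)"
    and t12: "0 < t1" "t1 \<le> t2" "ereal t2 < T"
  shows "r t2 y - r t1 y = - integral {t1..t2} (\<lambda>t. h t y)"
proof -
  obtain tb where tb: "t2 < tb" "ereal tb < T"
    using ereal_dense2[OF t12(3)] by auto
  \<comment> \<open>The smoothed window must stay inside (0,T), where test functions are supported.
    The bound 1 keeps the mollifier inside the compact set \<open>Q\<close> and the window shorter
    than t2 - t1 + 2.\<close>
  define \<epsilon>0 where "\<epsilon>0 = min (t1 / 2) (min (tb - t2) 1)"
  have \<epsilon>0: "0 < \<epsilon>0" "\<epsilon>0 \<le> t1 / 2" "\<epsilon>0 \<le> tb - t2" "\<epsilon>0 \<le> 1"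
    unfolding \<epsilon>0_def using t12 tb by linarith+
  define W where "W = {t1 - \<epsilon>0..t2 + \<epsilon>0}"
  have W: "t \<in> time_interval T" "t > 0" if "t \<in> W" for t
  proof -
    have "ereal t \<le> ereal tb" using that \<epsilon>0 by (simp add: W_def)
    also note tb(2)
    finally show "t \<in> time_interval T" "t > 0"
      using that \<epsilon>0 t12 by (auto simp: W_def time_interval_def)
  qed
  have cont_rW: "continuous_on (W \<times> S) (\<lambda>(t, x). r t x)" for S
    by (rule continuous_on_subset[OF cont_r]) (use W in auto)
  have cont_hW: "continuous_on (W \<times> S) (\<lambda>(t, x). h t x)" for S
    by (rule continuous_on_subset[OF cont_h]) (use W in auto)
  have cont_ht: "continuous_on W (\<lambda>t. h t x)" for x
    by (rule continuous_on_slice_fst[OF cont_hW UNIV_I])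
  have cont_rx: "continuous_on S (r t)" and cont_hx: "continuous_on S (h t)" if "t \<in> W" for t S
    using continuous_on_slice_snd[OF cont_rW that] continuous_on_slice_snd[OF cont_hW that] by auto
  have cont_g: "continuous_on S (g t)" if "t \<in> W" for t S
    using g'[OF W(1)[OF that]] by (auto intro!: continuous_at_imp_continuous_on DERIV_isCont)
  \<comment> \<open>Integrating \<open>a 0 t * h t y\<close> by parts against this antiderivative
    leaves only the derivative \<open>a 1\<close> of the time cutoff. The claim then becomes that r
    + A takes the same value at t1 and t2.\<close>
  define A where "A = (\<lambda>t. integral {t1 - \<epsilon>0..t} (\<lambda>\<tau>. h \<tau> y))"
  have A': "(A has_real_derivative h t y) (at t within W)" if "t \<in> W" for t
    unfolding A_def using integral_has_real_derivative[OF cont_ht[unfolded W_def], of t y] that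
    by (simp add: W_def)
  have cont_A: "continuous_on W A"
    using A' by (auto intro!: DERIV_continuous_on)
  have A12: "A t2 - A t1 = integral {t1..t2} (\<lambda>t. h t y)"
  proof -
    have "A t1 + integral {t1..t2} (\<lambda>t. h t y) = A t2"
      unfolding A_def by (rule Henstock_Kurzweil_Integration.integral_combine)
        (use t12 \<epsilon>0 in \<open>auto intro!: integrable_continuous_interval continuous_on_subset[OF cont_ht] simp: W_def\<close>)
    then show ?thesis by simp
  qed
  \<comment> \<open>The error budget: each end point costs 2 \<delta>, one \<delta> for
    \<open>r\<close> and one for \<open>A\<close>; replacing the mollified \<open>H\<close> by
    \<open>h\<close> costs \<delta> times the length of the window, at most t2 - t1 + 2.\<close>
  have main: "\<bar>(r t1 y + A t1) - (r t2 y + A t2)\<bar> \<le> \<delta> * (t2 - t1 + 6)" if "\<delta> > 0" for \<delta>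
  proof -
    define Q where "Q = W \<times> {y - 1..y + 1}"
    have "compact Q" unfolding Q_def W_def by (intro compact_Times compact_Icc)
    then have uc: "uniformly_continuous_on Q (\<lambda>(t, x). r t x)" "uniformly_continuous_on Q (\<lambda>(t, x). h t x)"
      unfolding Q_def by (auto intro!: compact_uniformly_continuous cont_rW cont_hW)
    obtain d1 where d1: "d1 > 0" "\<And>p q. p \<in> Q \<Longrightarrow> q \<in> Q \<Longrightarrow> dist q p < d1 \<Longrightarrow>
        dist (case q of (t, x) \<Rightarrow> r t x) (case p of (t, x) \<Rightarrow> r t x) < \<delta>"
      using uc(1) \<open>\<delta> > 0\<close> unfolding uniformly_continuous_on_def by metis
    obtain d2 where d2: "d2 > 0" "\<And>p q. p \<in> Q \<Longrightarrow> q \<in> Q \<Longrightarrow> dist q p < d2 \<Longrightarrow>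
        dist (case q of (t, x) \<Rightarrow> h t x) (case p of (t, x) \<Rightarrow> h t x) < \<delta>"
      using uc(2) \<open>\<delta> > 0\<close> unfolding uniformly_continuous_on_def by metis
    have "uniformly_continuous_on W A"
      by (rule compact_uniformly_continuous[OF cont_A]) (simp add: W_def)
    then obtain d3 where d3: "d3 > 0" "\<And>p q. p \<in> W \<Longrightarrow> q \<in> W \<Longrightarrow> dist q p < d3 \<Longrightarrow> dist (A q) (A p) < \<delta>"
      using \<open>\<delta> > 0\<close> unfolding uniformly_continuous_on_def by metis
    define \<epsilon> where "\<epsilon> = min (min \<epsilon>0 (d1 / 3)) (min (d2 / 3) (d3 / 3))"
    have \<epsilon>: "0 < \<epsilon>" "\<epsilon> \<le> \<epsilon>0" "2 * \<epsilon> < d1" "2 * \<epsilon> < d2" "\<epsilon> < d3"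
      unfolding \<epsilon>_def using \<epsilon>0 d1(1) d2(1) d3(1) by linarith+
    define W' where "W' = {t1 - \<epsilon>..t2 + \<epsilon>}"
    have W'W: "W' \<subseteq> W" using \<epsilon> by (auto simp: W_def W'_def)
    have dist2: "dist (t, x) (t', y) < d1" "dist (t, x) (t', y) < d2"
      if "\<bar>t - t'\<bar> \<le> \<epsilon>" "\<bar>x - y\<bar> \<le> \<epsilon>" for t t' x
      using sqrt_sum_squares_le_sum_abs[of "dist t t'" "dist x y"] that \<epsilon>
      by (auto simp: dist_Pair_Pair dist_real_def)
    have r_close: "\<bar>r t x - r t' y\<bar> \<le> \<delta>"
      if "t \<in> W" "t' \<in> W" "\<bar>t - t'\<bar> \<le> \<epsilon>" "\<bar>x - y\<bar> \<le> \<epsilon>" for t t' x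
      using d1(2)[of "(t', y)" "(t, x)"] dist2[OF that(3,4)] that \<epsilon> \<epsilon>0
      by (auto simp: Q_def dist_real_def abs_le_iff)
    have h_close: "\<bar>h t x - h t y\<bar> \<le> \<delta>" if "t \<in> W" "\<bar>x - y\<bar> \<le> \<epsilon>" for t x
      using d2(2)[of "(t, y)" "(t, x)"] dist2[of t t, OF _ that(2)] that \<epsilon> \<epsilon>0
      by (auto simp: Q_def dist_real_def abs_le_iff)
    obtain D :: "nat \<Rightarrow> real \<Rightarrow> real" where D: "\<And>n x. (D n has_real_derivative D (Suc n) x) (at x)"
      and D0: "\<And>x. x \<le> - \<epsilon> \<Longrightarrow> D 0 x = 0" "\<And>x. \<epsilon> \<le> x \<Longrightarrow> D 0 x = 1" "\<And>x. 0 \<le> D 0 x" "\<And>x. D 0 x \<le> 1"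
      and D1: "\<And>x. 0 \<le> D 1 x" "\<And>x. \<epsilon> \<le> \<bar>x\<bar> \<Longrightarrow> D 1 x = 0"
      and DS: "\<And>n x. \<epsilon> < \<bar>x\<bar> \<Longrightarrow> D (Suc n) x = 0"
      using smooth_step[OF \<open>\<epsilon> > 0\<close>] by metis
    have cont_D: "continuous_on S (D n)" for n S
      using D by (auto intro!: continuous_at_imp_continuous_on DERIV_isCont)
    have cont_Ds: "continuous_on S (\<lambda>x. D n (x - c))" for n S c
      by (rule continuous_on_compose2[OF cont_D[of UNIV]]) (auto intro!: continuous_intros)
    have D_shift: "((\<lambda>x. D n (x - c)) has_real_derivative D (Suc n) (x - c)) (at x)" for n c x
    proof -
      have "((\<lambda>x. x - c) has_real_derivative 1) (at x)" by (auto intro!: derivative_eq_intros)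
      from DERIV_chain'[OF this D[of n "x - c"]] show ?thesis by simp
    qed
    \<comment> \<open>The index in \<open>b\<close> is shifted by one, so \<open>b 0\<close> is
      already the mollifier. The time derivative \<open>a 1\<close> is a difference of mollifiers at
      t1 and t2, which is how the two end values are read off.\<close>
    define a where "a = (\<lambda>n t. D n (t - t1) - D n (t - t2))"
    define b where "b = (\<lambda>n x. D (Suc n) (x - y))"
    have a': "(a n has_real_derivative a (Suc n) t) (at t)" for n t
      unfolding a_def by (intro DERIV_diff D_shift)
    have b': "(b n has_real_derivative b (Suc n) x) (at x)" for n x
      unfolding b_def by (rule D_shift)
    have cont_a: "continuous_on S (a n)" and cont_b: "continuous_on S (b n)" for S n
      unfolding a_def b_def by (intro continuous_intros cont_Ds)+
    have a_out: "a 0 t = 0" "a 1 t = 0" if "t \<notin> W'" for t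
      using that t12 \<epsilon> D0(1,2)[of "t - t1"] D0(1,2)[of "t - t2"] D1(2)[of "t - t1"] D1(2)[of "t - t2"]
      by (auto simp: a_def W'_def not_le)
    have a_end: "a 0 (t1 - \<epsilon>) = 0" "a 0 (t2 + \<epsilon>) = 0"
      using t12 \<epsilon> by (auto simp: a_def D0)
    have a_bd: "\<bar>a 0 t\<bar> \<le> 1" for t
      using D0(3,4)[of "t - t1"] D0(3,4)[of "t - t2"] by (auto simp: a_def)
    have b_out: "b n x = 0" if "x \<notin> {y - \<epsilon>..y + \<epsilon>}" for n x
      using that DS[of "x - y" n] by (auto simp: b_def not_le)
    have b_nn: "0 \<le> b 0 x" for x using D1(1)[of "x - y"] by (simp add: b_def)
    have b_end: "b 0 (y - \<epsilon>) = 0" "b 0 (y + \<epsilon>) = 0"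
      using D1(2)[of \<epsilon>] D1(2)[of "-\<epsilon>"] \<epsilon> by (auto simp: b_def)
    define \<phi> where "\<phi> = (\<lambda>t x. a 0 t * b 0 x)"
    have test: "test_function T \<phi>"
      unfolding test_function_def
    proof (intro conjI exI[of _ "\<lambda>i j t x. a i t * b j x"] exI[of _ "W' \<times> {y - \<epsilon>..y + \<epsilon>}"] allI impI)
      show "(\<lambda>t x. a 0 t * b 0 x) = \<phi>" by (simp add: \<phi>_def)
      show "continuous_on UNIV (\<lambda>(t, x). a i t * b j x)" for i j
        unfolding case_prod_beta'
        by (intro continuous_intros continuous_on_compose2[OF cont_a[of UNIV]]
          continuous_on_compose2[OF cont_b[of UNIV]]) auto
      show "((\<lambda>\<tau>. a i \<tau> * b j x) has_real_derivative a (Suc i) t * b j x) (at t)" for i j t x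
        by (rule DERIV_cmult_right[OF a'])
      show "((\<lambda>y. a i t * b j y) has_real_derivative a i t * b (Suc j) x) (at x)" for i j t x
        by (rule DERIV_cmult[OF b'])
      show "compact (W' \<times> {y - \<epsilon>..y + \<epsilon>})"
        unfolding W'_def by (intro compact_Times compact_Icc)
      show "W' \<times> {y - \<epsilon>..y + \<epsilon>} \<subseteq> {(t, x). 0 < t \<and> ereal t < T}"
        using W W'W by (auto simp: time_interval_def)
      show "\<phi> t x = 0" if "(t, x) \<notin> W' \<times> {y - \<epsilon>..y + \<epsilon>}" for t x
        using that a_out b_out by (auto simp: \<phi>_def)
    qed
    have dt: "deriv (\<lambda>\<tau>. \<phi> \<tau> x) t = a 1 t * b 0 x" for t x
      unfolding \<phi>_def by (rule DERIV_imp_deriv) (use DERIV_cmult_right[OF a'[of 0]] in simp)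
    have dx: "deriv (\<lambda>y. 1 * \<phi> t y) x = a 0 t * b 1 x" for t x
      unfolding \<phi>_def by (rule DERIV_imp_deriv) (use DERIV_cmult[OF b'[of 0]] in simp)
    have weak0: "(LINT t|lborel. LINT x|lborel.
        r t x * (a 1 t * b 0 x) + g t x * (a 0 t * b 1 x) - 0 * \<phi> t x) = 0"
      using weak[unfolded weak_equation_def, rule_format, OF test] by (simp only: dt dx)
    let ?Y = "{y - \<epsilon>..y + \<epsilon>}"
    define P where "P = (\<lambda>t. integral ?Y (\<lambda>x. b 0 x * r t x))"
    define H where "H = (\<lambda>t. integral ?Y (\<lambda>x. b 0 x * h t x))"
    have b1: "(b 0 has_integral 1) ?Y"
    proof -
      have "(b 0 has_integral (D 0 (y + \<epsilon> - y) - D 0 (y - \<epsilon> - y))) ?Y"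
        unfolding b_def
        by (rule has_integral_real_derivative[OF _ has_field_derivative_at_within[OF D_shift]])
          (use \<epsilon> in simp)
      then show ?thesis using D0 by simp
    qed
    have P_close: "\<bar>P t - r t' y\<bar> \<le> \<delta>" if "t \<in> W" "t' \<in> W" "\<bar>t - t'\<bar> \<le> \<epsilon>" for t t'
      unfolding P_def
      by (rule weighted_mean_close[OF cont_b cont_rx[OF that(1)] b1])
        (use b_nn r_close[OF that] in \<open>auto simp: abs_le_iff\<close>)
    have H_close: "\<bar>H t - h t y\<bar> \<le> \<delta>" if "t \<in> W" for t
      unfolding H_def
      by (rule weighted_mean_close[OF cont_b cont_hx[OF that(1)] b1])
        (use b_nn h_close[OF that] in \<open>auto simp: abs_le_iff\<close>)
    \<comment> \<open>Integration by parts in x moves the derivative from the mollifier to the flux,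
      whose derivative is \<open>h\<close>; boundary terms vanish with \<open>b 0\<close> at the
      ends of \<open>?Y\<close>.\<close>
    have inner: "(LINT x|lborel. r t x * (a 1 t * b 0 x) + g t x * (a 0 t * b 1 x) - 0 * \<phi> t x)
        = a 1 t * P t - a 0 t * H t" (is "?l = _") if "t \<in> W" for t
    proof -
      have "?l = integral ?Y (\<lambda>x. a 1 t * (b 0 x * r t x) + a 0 t * (g t x * b 1 x))"
        by (rule LINT_supported_Icc)
          (simp_all add: b_out algebra_simps continuous_intros cont_b cont_rx[OF that] cont_g[OF that] del: atLeastAtMost_iff One_nat_def)
      also have "(\<lambda>x. a 1 t * (b 0 x * r t x) + a 0 t * (g t x * b 1 x)) =
          (\<lambda>x. (a 1 t * (b 0 x * r t x) - a 0 t * (b 0 x * h t x)) + a 0 t * (b 0 x * h t x + g t x * b 1 x))"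
        by (simp add: algebra_simps)
      also have "integral ?Y \<dots> = a 1 t * P t - a 0 t * H t"
      proof (rule integral_unique)
        have 1: "((\<lambda>x. b 0 x * h t x + g t x * b 1 x) has_integral
            (b 0 (y + \<epsilon>) * g t (y + \<epsilon>) - b 0 (y - \<epsilon>) * g t (y - \<epsilon>))) ?Y"
        proof (rule has_integral_real_derivative)
          fix x assume "x \<in> ?Y"
          have "((\<lambda>x. b 0 x * g t x) has_real_derivative b 1 x * g t x + h t x * b 0 x) (at x)"
            using DERIV_mult[OF b'[of 0 x] g'[OF W(1)[OF that], of x]] by simp
          also have "b 1 x * g t x + h t x * b 0 x = b 0 x * h t x + g t x * b 1 x" by simp
          finally show "((\<lambda>x. b 0 x * g t x) has_real_derivative b 0 x * h t x + g t x * b 1 x) (at x within ?Y)"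
            by (rule has_field_derivative_at_within)
        qed (use \<epsilon> in simp)
        have 2: "((\<lambda>x. b 0 x * r t x) has_integral P t) ?Y" "((\<lambda>x. b 0 x * h t x) has_integral H t) ?Y"
          unfolding P_def H_def
          by (intro integrable_integral integrable_continuous_interval continuous_intros cont_b cont_rx cont_hx that)+
        show "((\<lambda>x. (a 1 t * (b 0 x * r t x) - a 0 t * (b 0 x * h t x)) + a 0 t * (b 0 x * h t x + g t x * b 1 x))
            has_integral (a 1 t * P t - a 0 t * H t)) ?Y"
          using has_integral_add[OF has_integral_diff[OF has_integral_mult_right[OF 2(1), of "a 1 t"]
              has_integral_mult_right[OF 2(2), of "a 0 t"]] has_integral_mult_right[OF 1, of "a 0 t"]]
          by (simp add: b_end)
      qed
      finally show ?thesis .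
    qed
    have cont_PH: "continuous_on W' P" "continuous_on W' H" and cont_A': "continuous_on W' A"
    proof -
      have "continuous_on (W \<times> cbox (y - \<epsilon>) (y + \<epsilon>)) (\<lambda>(t, x). b 0 x * r t x)"
        "continuous_on (W \<times> cbox (y - \<epsilon>) (y + \<epsilon>)) (\<lambda>(t, x). b 0 x * h t x)"
        unfolding case_prod_beta'
        by (intro continuous_on_mult continuous_on_compose2[OF cont_b[of UNIV]] continuous_on_snd
            continuous_on_id cont_rW[unfolded case_prod_beta'] cont_hW[unfolded case_prod_beta']; simp)+
      from integral_continuous_on_param[OF this(1)] integral_continuous_on_param[OF this(2)]
      show "continuous_on W' P" "continuous_on W' H"
        unfolding P_def H_def cbox_interval by (auto intro: continuous_on_subset[OF _ W'W])
      show "continuous_on W' A" by (rule continuous_on_subset[OF cont_A W'W])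
    qed
    have cont_aPH: "continuous_on W' (\<lambda>t. a 1 t * P t - a 0 t * H t)"
      by (intro continuous_intros cont_a cont_PH)
    have "integral W' (\<lambda>t. a 1 t * P t - a 0 t * H t) = 0"
      using LINT_supported_Icc[OF cont_aPH[unfolded W'_def], folded W'_def, OF _ inner] W'W
      unfolding weak0 by (simp add: a_out subset_iff del: One_nat_def)
    moreover have "(\<lambda>t. a 1 t * P t - a 0 t * H t) integrable_on W'"
      using cont_aPH unfolding W'_def by (rule integrable_continuous_interval)
    ultimately have 1: "((\<lambda>t. a 1 t * P t - a 0 t * H t) has_integral 0) W'"
      by (metis integrable_integral)
    have 2: "((\<lambda>t. a 0 t * h t y + a 1 t * A t) has_integral
        (a 0 (t2 + \<epsilon>) * A (t2 + \<epsilon>) - a 0 (t1 - \<epsilon>) * A (t1 - \<epsilon>))) W'"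
      unfolding W'_def
    proof (rule has_integral_real_derivative)
      show "t1 - \<epsilon> \<le> t2 + \<epsilon>" using t12 \<epsilon> by simp
      fix t assume "t \<in> {t1 - \<epsilon>..t2 + \<epsilon>}"
      then have t: "t \<in> W'" by (simp add: W'_def)
      then have "(A has_real_derivative h t y) (at t within W')"
        using has_field_derivative_subset[OF A' W'W] W'W by auto
      from DERIV_mult[OF has_field_derivative_at_within[OF a'[of 0 t]] this]
      show "((\<lambda>t. a 0 t * A t) has_real_derivative a 0 t * h t y + a 1 t * A t)
          (at t within {t1 - \<epsilon>..t2 + \<epsilon>})"
        unfolding W'_def by (rule DERIV_cong) simp
    qed
    have 3: "((\<lambda>t. a 1 t * (P t + A t)) has_integral integral W' (\<lambda>t. a 1 t * (P t + A t))) W'"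
      unfolding W'_def by (intro integrable_integral integrable_continuous_interval
        continuous_intros cont_a cont_PH[unfolded W'_def] cont_A'[unfolded W'_def])
    \<comment> \<open>Subtracting the weak equation and the total derivative of
      \<open>a 0 t * A t\<close>, both of integral 0, leaves only the mollification error of
      \<open>h\<close>.\<close>
    have "a 1 t * (P t + A t) - ((a 1 t * P t - a 0 t * H t) + (a 0 t * h t y + a 1 t * A t))
        = a 0 t * (H t - h t y)" for t
      by (simp add: algebra_simps)
    with has_integral_diff[OF 3 has_integral_add[OF 1 2]]
    have J: "((\<lambda>t. a 0 t * (H t - h t y)) has_integral integral W' (\<lambda>t. a 1 t * (P t + A t)))
        (cbox (t1 - \<epsilon>) (t2 + \<epsilon>))"
      by (simp add: a_end W'_def cbox_interval del: One_nat_def)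
    have "norm (integral W' (\<lambda>t. a 1 t * (P t + A t))) \<le> \<delta> * measure lborel (cbox (t1 - \<epsilon>) (t2 + \<epsilon>))"
    proof (rule has_integral_bound[OF _ J])
      show "norm (a 0 t * (H t - h t y)) \<le> \<delta>" if "t \<in> cbox (t1 - \<epsilon>) (t2 + \<epsilon>)" for t
      proof -
        have "t \<in> W" using that W'W by (auto simp: W'_def)
        then show ?thesis
          using mult_mono[OF a_bd[of t] H_close[of t]] by (simp add: abs_mult)
      qed
    qed (use \<open>\<delta> > 0\<close> in simp)
    also have "\<dots> \<le> \<delta> * (t2 - t1 + 2)"
      using t12 \<epsilon> \<epsilon>0 \<open>\<delta> > 0\<close> by simp
    finally have I: "\<bar>integral W' (\<lambda>t. a 1 t * (P t + A t))\<bar> \<le> \<delta> * (t2 - t1 + 2)"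
      by simp
    have D_int: "((\<lambda>t. D 1 (t - t')) has_integral 1) W'" if "t' \<in> {t1, t2}" for t'
    proof -
      have "((\<lambda>t. D 1 (t - t')) has_integral (D 0 (t2 + \<epsilon> - t') - D 0 (t1 - \<epsilon> - t'))) W'"
        unfolding W'_def
        using has_integral_real_derivative[OF _ has_field_derivative_at_within[OF D_shift[of 0 t']], of "t1 - \<epsilon>" "t2 + \<epsilon>"] t12 \<epsilon>
        by simp
      then show ?thesis using that D0 t12 by auto
    qed
    have PA: "\<bar>integral W' (\<lambda>t. D 1 (t - t') * (P t + A t)) - (r t' y + A t')\<bar> \<le> 2 * \<delta>"
      if t': "t' \<in> {t1, t2}" for t'
      unfolding W'_def
    proof (rule weighted_mean_close)
      have t'W: "t' \<in> W" using t' t12 \<epsilon>0 by (auto simp: W_def)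
      show "((\<lambda>t. D 1 (t - t')) has_integral 1) {t1 - \<epsilon>..t2 + \<epsilon>}"
        using D_int[OF t'] by (simp add: W'_def)
      show "continuous_on {t1 - \<epsilon>..t2 + \<epsilon>} (\<lambda>t. P t + A t)"
        by (intro continuous_intros cont_PH[unfolded W'_def] cont_A'[unfolded W'_def])
      fix t assume "t \<in> {t1 - \<epsilon>..t2 + \<epsilon>}" and nz: "D 1 (t - t') \<noteq> 0"
      then have t: "t \<in> W" using W'W by (auto simp: W'_def)
      have "\<bar>t - t'\<bar> \<le> \<epsilon>" using nz D1(2)[of "t - t'"] by linarith
      then show "\<bar>P t + A t - (r t' y + A t')\<bar> \<le> 2 * \<delta>"
        using P_close[OF t t'W] d3(2)[OF t'W t] \<epsilon> unfolding dist_real_def by linarith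
    qed (use D1 cont_Ds in auto)
    have "integral W' (\<lambda>t. a 1 t * (P t + A t)) =
        integral W' (\<lambda>t. D 1 (t - t1) * (P t + A t) - D 1 (t - t2) * (P t + A t))"
      by (simp add: a_def algebra_simps)
    also have "\<dots> = integral W' (\<lambda>t. D 1 (t - t1) * (P t + A t)) - integral W' (\<lambda>t. D 1 (t - t2) * (P t + A t))"
      unfolding W'_def by (intro integral_diff integrable_continuous_interval
        continuous_intros cont_Ds cont_PH[unfolded W'_def] cont_A'[unfolded W'_def])
    finally have split: "integral W' (\<lambda>t. a 1 t * (P t + A t)) = \<dots>" .
    show ?thesis
    proof -
      have "\<delta> * (t2 - t1 + 6) = \<delta> * (t2 - t1 + 2) + 2 * \<delta> + 2 * \<delta>" by (simp add: algebra_simps)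
      moreover have "t1 \<in> {t1, t2}" "t2 \<in> {t1, t2}" by auto
      note PA[OF this(1)] PA[OF this(2)]
      ultimately show ?thesis
        using I split by linarith
    qed
  qed
  have "\<bar>(r t1 y + A t1) - (r t2 y + A t2)\<bar> \<le> 0"
  proof (rule field_le_epsilon)
    fix e :: real assume "e > 0"
    moreover have "0 < t2 - t1 + 6" using t12 by simp
    ultimately have "0 < e / (t2 - t1 + 6)" "e / (t2 - t1 + 6) * (t2 - t1 + 6) = e" by simp_all
    then show "\<bar>(r t1 y + A t1) - (r t2 y + A t2)\<bar> \<le> 0 + e"
      using main[of "e / (t2 - t1 + 6)"] by linarith
  qed
  then show ?thesis using A12 by simp
qed

text \<open>At a positive maximum of \<open>exp (- K t) * r t y\<close> over the backward cone with \<open>t > 0\<close>, stepping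
  back along the characteristic direction stays inside the cone and strictly increases the value.\<close>

lemma continuity_equation_upper_bound:
  fixes r rx c cx h :: "real \<Rightarrow> real \<Rightarrow> real"
  assumes cont_r: "continuous_on ({0..T0} \<times> UNIV) (\<lambda>(t, y). r t y)"
    and cont_h: "continuous_on ({0..T0} \<times> UNIV) (\<lambda>(t, y). h t y)"
    and r_x: "\<And>t y. 0 < t \<Longrightarrow> t \<le> T0 \<Longrightarrow> (r t has_real_derivative rx t y) (at y)"
    and h: "\<And>t y. 0 < t \<Longrightarrow> t \<le> T0 \<Longrightarrow> h t y = cx t y * r t y + c t y * rx t y"
    and c: "\<And>t y. 0 < t \<Longrightarrow> t \<le> T0 \<Longrightarrow> \<bar>c t y\<bar> \<le> M"
    and cx: "\<And>t y. 0 < t \<Longrightarrow> t \<le> T0 \<Longrightarrow> \<bar>cx t y\<bar> \<le> M"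
    and r_t: "\<And>t1 t2 y. 0 < t1 \<Longrightarrow> t1 \<le> t2 \<Longrightarrow> t2 \<le> T0 \<Longrightarrow>
        r t2 y - r t1 y = - integral {t1..t2} (\<lambda>t. h t y)"
    and t0: "0 \<le> t0" "t0 \<le> T0"
    and init: "\<And>y. \<bar>y - x0\<bar> \<le> M * t0 \<Longrightarrow> r 0 y \<le> B" and "0 \<le> B" and "0 \<le> M"
  shows "r t0 x0 \<le> exp ((M + 1) * t0) * B"
proof -
  \<comment> \<open>Exceeding the bound on |cx| by 1 ensures \<open>K + cx t y > 0\<close>, so that
    the backward step gains strictly.\<close>
  define K where "K = M + 1"
  \<comment> \<open>The slope M bounds the velocity, so no characteristic followed backward leaves
    the cone. Its base at time 0 is the set on which \<open>init\<close> provides the bound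
    B.\<close>
  define C where "C = {0..t0} \<times> UNIV \<inter> {p. \<bar>snd p - x0\<bar> \<le> M * (t0 - fst p)}"
  define z where "z = (\<lambda>p. exp (- (K * fst p)) * r (fst p) (snd p))"
  have "C \<subseteq> {0..t0} \<times> {x0 - M * t0 .. x0 + M * t0}"
  proof
    fix p assume "p \<in> C"
    then have p: "0 \<le> fst p" "fst p \<le> t0" "\<bar>snd p - x0\<bar> \<le> M * (t0 - fst p)"
      by (auto simp: C_def)
    have "M * (t0 - fst p) \<le> M * t0" using p \<open>0 \<le> M\<close> by (intro mult_left_mono) auto
    then show "p \<in> {0..t0} \<times> {x0 - M * t0 .. x0 + M * t0}"
      using p by (cases p) (auto simp: abs_le_iff)
  qed
  moreover have "compact ({0..t0} \<times> {x0 - M * t0 .. x0 + M * t0})"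
    by (intro compact_Times compact_Icc)
  moreover have "closed C"
    unfolding C_def by (intro closed_Int closed_Times closed_Collect_le continuous_intros)
  ultimately have "compact C"
    by (metis compact_Int_closed inf.absorb_iff2)
  moreover have "(t0, x0) \<in> C"
    using t0 by (simp add: C_def)
  then have "C \<noteq> {}" by blast
  moreover have "continuous_on C z"
  proof -
    have "continuous_on C (\<lambda>p. case p of (t, y) \<Rightarrow> r t y)"
      by (rule continuous_on_subset[OF cont_r]) (use t0 in \<open>auto simp: C_def\<close>)
    then show ?thesis
      unfolding z_def by (intro continuous_intros) (simp add: case_prod_beta')
  qed
  ultimately obtain p where p: "p \<in> C" "\<And>q. q \<in> C \<Longrightarrow> z q \<le> z p"
    using continuous_attains_sup[of C z] by blast
  obtain t y where ty: "p = (t, y)" by (cases p)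
  have t: "0 \<le> t" "t \<le> t0" "\<bar>y - x0\<bar> \<le> M * (t0 - t)"
    using p(1) by (auto simp: C_def ty)
  have top: "z (t0, x0) \<le> z (t, y)"
    using p(2)[of "(t0, x0)"] t0 by (auto simp: C_def ty)
  have "z (t, y) \<le> B"
  proof (rule ccontr)
    assume "\<not> z (t, y) \<le> B"
    then have zB: "z (t, y) > B" by simp
    have "t \<noteq> 0"
    proof
      assume "t = 0"
      then have "z (t, y) \<le> B" using init[of y] t by (simp add: z_def)
      with zB show False by simp
    qed
    with t have "t > 0" by simp
    \<comment> \<open>The time increment at the shifted position: by \<open>r_t\<close>, the value
      of r at (t - \<sigma>, y - c \<sigma>) equals r at (t, y - c \<sigma>) plus
      \<open>G \<sigma>\<close>. This replaces a time derivative of r.\<close>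
    define G where "G = (\<lambda>\<sigma>. integral {t - \<sigma>..t} (\<lambda>\<tau>. h \<tau> (y - c t y * \<sigma>)))"
    \<comment> \<open>\<open>G \<sigma> / \<sigma>\<close> averages \<open>h\<close> over points at
      distance at most (1 + M) \<sigma> from (t, y), so continuity of \<open>h\<close> is enough.
      The derivative is one-sided because only backward steps are considered.\<close>
    have G': "(G has_real_derivative h t y) (at 0 within {0..})"
    proof -
      have "((\<lambda>\<sigma>. (G \<sigma> - G 0) / (\<sigma> - 0)) \<longlongrightarrow> h t y) (at 0 within {0..})"
      proof (rule tendstoI)
        fix e :: real assume "e > 0"
        have "(t, y) \<in> {0..T0} \<times> UNIV" using t t0 by auto
        with cont_h \<open>e > 0\<close> obtain d where d: "d > 0"
          "\<And>q. q \<in> {0..T0} \<times> UNIV \<Longrightarrow> dist q (t, y) < d \<Longrightarrow> dist (case q of (t, y) \<Rightarrow> h t y) (h t y) < e / 2"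
          unfolding continuous_on_iff by (metis case_prod_conv half_gt_zero)
        define d' where "d' = min t (d / (2 + M))"
        have "d' > 0" using \<open>t > 0\<close> d \<open>0 \<le> M\<close> by (simp add: d'_def)
        have "dist ((G \<sigma> - G 0) / (\<sigma> - 0)) (h t y) < e" if \<sigma>: "0 < \<sigma>" "\<sigma> < d'" for \<sigma>
        proof -
          let ?y = "y - c t y * \<sigma>"
          have \<sigma>': "\<sigma> < t" "\<sigma> * (2 + M) < d"
            using \<sigma> \<open>0 \<le> M\<close> by (auto simp: d'_def field_simps)
          have near: "norm (h \<tau> ?y - h t y) \<le> e / 2" if "\<tau> \<in> {t - \<sigma>..t}" for \<tau>
          proof -
            have "\<bar>c t y * \<sigma>\<bar> \<le> M * \<sigma>"
              using c[of t y] \<open>t > 0\<close> t t0 \<sigma> by (auto simp: abs_mult intro!: mult_right_mono)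
            moreover have "dist (\<tau>, ?y) (t, y) \<le> \<bar>\<tau> - t\<bar> + \<bar>c t y * \<sigma>\<bar>"
              using sqrt_sum_squares_le_sum_abs[of "dist \<tau> t" "dist ?y y"]
              by (simp add: dist_Pair_Pair dist_real_def)
            ultimately have "dist (\<tau>, ?y) (t, y) < d"
              using that \<sigma>'(2) \<sigma> by (auto simp: algebra_simps)
            then have "dist (h \<tau> ?y) (h t y) < e / 2"
              using d(2)[of "(\<tau>, ?y)"] that \<sigma>' t t0 by auto
            then show ?thesis by (simp add: dist_real_def)
          qed
          have "continuous_on {t - \<sigma>..t} (\<lambda>\<tau>. h \<tau> ?y)"
            by (rule continuous_on_subset[OF continuous_on_slice_fst[OF cont_h]]) (use \<sigma>' t t0 in auto)
          then have int: "(\<lambda>\<tau>. h \<tau> ?y) integrable_on {t - \<sigma>..t}"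
            by (rule integrable_continuous_interval)
          have "((\<lambda>\<tau>. h \<tau> ?y - h t y) has_integral (G \<sigma> - \<sigma> * h t y)) {t - \<sigma>..t}"
            unfolding G_def using has_integral_diff[OF integrable_integral[OF int]
              has_integral_const_real[of "h t y" "t - \<sigma>" t]] \<sigma> by simp
          then have "norm (G \<sigma> - \<sigma> * h t y) \<le> e / 2 * measure lborel (cbox (t - \<sigma>) t)"
            using near \<open>e > 0\<close> by (intro has_integral_bound[of "e / 2"]) auto
          then have "\<bar>G \<sigma> - \<sigma> * h t y\<bar> \<le> e / 2 * \<sigma>" using \<sigma> by simp
          then have "\<bar>G \<sigma> / \<sigma> - h t y\<bar> \<le> e / 2"
            using \<sigma> by (simp add: field_simps abs_le_iff)
          then show ?thesis using \<open>e > 0\<close> by (simp add: G_def dist_real_def)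
        qed
        then show "\<forall>\<^sub>F \<sigma> in at 0 within {0..}. dist ((G \<sigma> - G 0) / (\<sigma> - 0)) (h t y) < e"
          using \<open>d' > 0\<close> unfolding eventually_at by (auto intro!: exI[of _ d'] simp: dist_real_def)
      qed
      then show ?thesis by (simp add: has_field_derivative_iff)
    qed
    \<comment> \<open>The value of \<open>z\<close> after a backward step of length \<sigma>. At
      \<sigma> = 0 the transport terms cancel, since - c rx + h = cx r, and the derivative keeps
      only the factor K + cx.\<close>
    define k where "k = (\<lambda>\<sigma>. exp (- (K * (t - \<sigma>))) * (r t (y - c t y * \<sigma>) + G \<sigma>))"
    have "((\<lambda>\<sigma>. r t (y - c t y * \<sigma>)) has_real_derivative rx t (y - c t y * 0) * - c t y) (at 0 within {0..})"
      by (rule DERIV_chain'[OF _ r_x]) (use \<open>t > 0\<close> t t0 in \<open>auto intro!: derivative_eq_intros\<close>)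
    then have "((\<lambda>\<sigma>. r t (y - c t y * \<sigma>) + G \<sigma>) has_real_derivative
        (rx t y * - c t y + h t y)) (at 0 within {0..})"
      by (intro DERIV_add G') simp
    moreover have "((\<lambda>\<sigma>. exp (- (K * (t - \<sigma>)))) has_real_derivative exp (- (K * t)) * K) (at 0 within {0..})"
      by (auto intro!: derivative_eq_intros)
    ultimately have k': "(k has_real_derivative exp (- (K * t)) * ((K + cx t y) * r t y)) (at 0 within {0..})"
      unfolding k_def using h[of t y] \<open>t > 0\<close> t t0
      by (intro DERIV_mult[THEN DERIV_cong]) (auto simp: algebra_simps G_def)
    have "r t y > 0"
      using zB \<open>0 \<le> B\<close> by (auto simp: z_def zero_less_mult_iff dest: order.strict_trans1)
    moreover have "K + cx t y > 0"
      using cx[of t y] \<open>t > 0\<close> t t0 by (auto simp: K_def)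
    ultimately have "exp (- (K * t)) * ((K + cx t y) * r t y) > 0" by simp
    from has_real_derivative_pos_inc_right[OF k' this] obtain d where d: "d > 0"
      "\<And>\<sigma>. \<sigma> > 0 \<Longrightarrow> 0 + \<sigma> \<in> {0..} \<Longrightarrow> \<sigma> < d \<Longrightarrow> k 0 < k (0 + \<sigma>)" by blast
    \<comment> \<open>Half of t keeps t - \<sigma> positive: the integrated equation is available
      only at positive times, and time 0 enters through continuity on the cone.\<close>
    define \<sigma> where "\<sigma> = min (t / 2) (d / 2)"
    have \<sigma>: "0 < \<sigma>" "\<sigma> < t" "\<sigma> < d" using \<open>t > 0\<close> \<open>d > 0\<close> by (auto simp: \<sigma>_def)
    have "k 0 = z (t, y)" by (simp add: k_def z_def G_def)
    moreover have "k \<sigma> = z (t - \<sigma>, y - c t y * \<sigma>)"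
      using r_t[of "t - \<sigma>" t "y - c t y * \<sigma>"] \<sigma> t t0 by (simp add: k_def z_def G_def)
    moreover have "(t - \<sigma>, y - c t y * \<sigma>) \<in> C"
    proof -
      have "\<bar>c t y * \<sigma>\<bar> \<le> M * \<sigma>"
        using c[of t y] \<open>t > 0\<close> t t0 \<sigma> by (auto simp: abs_mult intro!: mult_right_mono)
      then show ?thesis using t \<sigma> by (auto simp: C_def algebra_simps)
    qed
    then have "z (t - \<sigma>, y - c t y * \<sigma>) \<le> z (t, y)" using p(2) by (simp add: ty)
    ultimately show False using d(2)[of \<sigma>] \<sigma> by simp
  qed
  with top have "exp (- (K * t0)) * r t0 x0 \<le> B" by (simp add: z_def)
  then have "exp (K * t0) * (exp (- (K * t0)) * r t0 x0) \<le> exp (K * t0) * B"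
    by (intro mult_left_mono) auto
  then show ?thesis by (simp add: K_def mult.assoc[symmetric] exp_add[symmetric] del: mult.assoc)
qed

text \<open>For fixed c and cx the equation is linear in r, so the one-sided bound applies to both r
  and -r.\<close>

lemma continuity_equation_bound:
  fixes r rx c cx h :: "real \<Rightarrow> real \<Rightarrow> real"
  assumes cont_r: "continuous_on ({0..T0} \<times> UNIV) (\<lambda>(t, y). r t y)"
    and cont_h: "continuous_on ({0..T0} \<times> UNIV) (\<lambda>(t, y). h t y)"
    and r_x: "\<And>t y. 0 < t \<Longrightarrow> t \<le> T0 \<Longrightarrow> (r t has_real_derivative rx t y) (at y)"
    and h: "\<And>t y. 0 < t \<Longrightarrow> t \<le> T0 \<Longrightarrow> h t y = cx t y * r t y + c t y * rx t y"
    and c: "\<And>t y. 0 < t \<Longrightarrow> t \<le> T0 \<Longrightarrow> \<bar>c t y\<bar> \<le> M"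
    and cx: "\<And>t y. 0 < t \<Longrightarrow> t \<le> T0 \<Longrightarrow> \<bar>cx t y\<bar> \<le> M"
    and r_t: "\<And>t1 t2 y. 0 < t1 \<Longrightarrow> t1 \<le> t2 \<Longrightarrow> t2 \<le> T0 \<Longrightarrow>
        r t2 y - r t1 y = - integral {t1..t2} (\<lambda>t. h t y)"
    and t0: "0 \<le> t0" "t0 \<le> T0"
    and init: "\<And>y. \<bar>y - x0\<bar> \<le> M * t0 \<Longrightarrow> \<bar>r 0 y\<bar> \<le> B" and "0 \<le> M"
  shows "\<bar>r t0 x0\<bar> \<le> exp ((M + 1) * t0) * B"
proof -
  have "0 \<le> B" using init[of x0] t0 \<open>0 \<le> M\<close> by (auto intro: order_trans[OF abs_ge_zero])
  have "r t0 x0 \<le> exp ((M + 1) * t0) * B"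
    by (rule continuity_equation_upper_bound[OF cont_r cont_h r_x h c cx r_t t0 _ \<open>0 \<le> B\<close> \<open>0 \<le> M\<close>])
      (use init in \<open>auto simp: abs_le_iff\<close>)
  moreover have "- r t0 x0 \<le> exp ((M + 1) * t0) * B"
  proof (rule continuity_equation_upper_bound[where r = "\<lambda>t y. - r t y" and rx = "\<lambda>t y. - rx t y"
      and h = "\<lambda>t y. - h t y" and c = c and cx = cx and ?T0.0 = T0 and ?t0.0 = t0])
    show "continuous_on ({0..T0} \<times> UNIV) (\<lambda>(t, y). - r t y)"
      using continuous_on_minus[OF cont_r] by (simp add: case_prod_beta')
    show "continuous_on ({0..T0} \<times> UNIV) (\<lambda>(t, y). - h t y)"
      using continuous_on_minus[OF cont_h] by (simp add: case_prod_beta')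
    show "- r t2 y - - r t1 y = - integral {t1..t2} (\<lambda>t. - h t y)"
      if "0 < t1" "t1 \<le> t2" "t2 \<le> T0" for t1 t2 y
      using r_t[OF that, of y] by simp
  qed (use init t0 c cx h \<open>0 \<le> B\<close> \<open>0 \<le> M\<close> in \<open>auto intro!: derivative_eq_intros r_x simp: abs_le_iff\<close>)
  ultimately show ?thesis by (simp add: abs_le_iff)
qed

section \<open>Persistence of the decay\<close>

text \<open>The increment is split at (t, z): moving in time is small uniformly in z by
  \<open>bound\<close>, and moving in space uses continuity of the single slice
  \<open>G t\<close>.\<close>

lemma continuous_on_Times_uniform:
  fixes G :: "real \<Rightarrow> real \<Rightarrow> real"
  assumes cont: "\<And>t. t \<in> I \<Longrightarrow> continuous_on UNIV (G t)"
    and lim: "\<And>t. t \<in> I \<Longrightarrow> ((\<lambda>\<tau>. n \<tau> t) \<longlongrightarrow> 0) (at t within I)"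
    and bound: "\<And>\<tau> t y. \<tau> \<in> I \<Longrightarrow> t \<in> I \<Longrightarrow> \<bar>G \<tau> y - G t y\<bar> \<le> C * n \<tau> t"
  shows "continuous_on (I \<times> UNIV) (\<lambda>(t, y). G t y)"
  unfolding continuous_on_iff
proof (intro ballI allI impI)
  fix p :: "real \<times> real" and e :: real assume "p \<in> I \<times> UNIV" "e > 0"
  then obtain t y where p: "p = (t, y)" "t \<in> I" by auto
  have "((\<lambda>\<tau>. C * n \<tau> t) \<longlongrightarrow> 0) (at t within I)"
    using tendsto_mult_right_zero[OF lim[OF p(2)]] .
  from tendstoD[OF this, of "e / 2"] \<open>e > 0\<close> obtain d1 where d1: "d1 > 0"
    "\<forall>\<tau>\<in>I. \<tau> \<noteq> t \<and> dist \<tau> t < d1 \<longrightarrow> dist (C * n \<tau> t) 0 < e / 2"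
    unfolding eventually_at by auto
  from cont[OF p(2)] \<open>e > 0\<close> obtain d2 where d2: "d2 > 0"
    "\<And>z. dist z y < d2 \<Longrightarrow> dist (G t z) (G t y) < e / 2"
    unfolding continuous_on_iff by (metis UNIV_I half_gt_zero)
  show "\<exists>d>0. \<forall>q\<in>I \<times> UNIV. dist q p < d \<longrightarrow>
      dist (case q of (t, y) \<Rightarrow> G t y) (case p of (t, y) \<Rightarrow> G t y) < e"
  proof (intro exI[of _ "min d1 d2"] conjI ballI impI)
    fix q assume "q \<in> I \<times> UNIV" and qd: "dist q p < min d1 d2"
    then obtain \<tau> z where q: "q = (\<tau>, z)" "\<tau> \<in> I" by auto
    have "dist \<tau> t < d1" "dist z y < d2"
      using qd dist_fst_le[of q p] dist_snd_le[of q p] by (auto simp: p q)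
    moreover from this have "\<bar>G \<tau> z - G t z\<bar> < e / 2"
      using d1(2)[rule_format, OF q(2)] bound[OF q(2) p(2), of z] \<open>e > 0\<close>
      by (cases "\<tau> = t") (auto simp: dist_real_def)
    ultimately have "\<bar>G \<tau> z - G t z\<bar> < e / 2" "\<bar>G t z - G t y\<bar> < e / 2"
      using d2(2)[of z] by (auto simp: dist_real_def)
    then show "dist (case q of (t, y) \<Rightarrow> G t y) (case p of (t, y) \<Rightarrow> G t y) < e"
      unfolding p q prod.case dist_real_def by linarith
  qed (use d1 d2 in auto)
qed

text \<open>The embedding turns distances in the Sobolev norm into uniform distances of the
  functions and of their derivatives, whence joint continuity. The last claim uses continuity of the
  curve at time 0 only.\<close>

lemma sobolev_curve_C1:
  assumes s: "s > 3 / 2" and f: "sobolev_curve s T f"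
  shows "\<And>t x. t \<in> time_interval T \<Longrightarrow> (f t has_real_derivative deriv (f t) x) (at x)"
    and "continuous_on (time_interval T \<times> UNIV) (\<lambda>(t, x). f t x)"
    and "continuous_on (time_interval T \<times> UNIV) (\<lambda>(t, x). deriv (f t) x)"
    and "T > 0 \<Longrightarrow> \<exists>\<delta>>0. \<exists>B\<ge>0. \<forall>t\<in>time_interval T. t \<le> \<delta> \<longrightarrow> (\<forall>x. \<bar>f t x\<bar> \<le> B \<and> \<bar>deriv (f t) x\<bar> \<le> B)"
proof -
  obtain C where C: "0 \<le> C"
    "\<And>f x. f \<in> sobolev_cont s \<Longrightarrow> (f has_real_derivative deriv f x) (at x)"
    "\<And>f. f \<in> sobolev_cont s \<Longrightarrow> continuous_on UNIV (deriv f)"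
    "\<And>f x. f \<in> sobolev_cont s \<Longrightarrow> \<bar>f x\<bar> \<le> C * sobolev_norm s f"
    "\<And>f x. f \<in> sobolev_cont s \<Longrightarrow> \<bar>deriv f x\<bar> \<le> C * sobolev_norm s f"
    using sobolev_C1_embedding[OF s] by blast
  have mem: "f t \<in> sobolev_cont s" if "t \<in> time_interval T" for t
    using f that by (simp add: sobolev_curve_def)
  define n where "n = (\<lambda>\<tau> t. sobolev_norm s (\<lambda>x. f \<tau> x - f t x))"
  have lim: "((\<lambda>\<tau>. n \<tau> t) \<longlongrightarrow> 0) (at t within time_interval T)" if "t \<in> time_interval T" for t
    using f that by (simp add: sobolev_curve_def n_def)
  show deriv: "(f t has_real_derivative deriv (f t) x) (at x)" if "t \<in> time_interval T" for t x
    by (rule C(2)[OF mem[OF that]])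
  have bound: "\<bar>f \<tau> y - f t y\<bar> \<le> C * n \<tau> t" "\<bar>deriv (f \<tau>) y - deriv (f t) y\<bar> \<le> C * n \<tau> t"
    if "\<tau> \<in> time_interval T" "t \<in> time_interval T" for \<tau> t y
  proof -
    note d = sobolev_cont_diff[OF mem[OF that(1)] mem[OF that(2)]]
    show "\<bar>f \<tau> y - f t y\<bar> \<le> C * n \<tau> t"
      using C(4)[OF d, of y] by (simp add: n_def)
    have "deriv (\<lambda>x. f \<tau> x - f t x) y = deriv (f \<tau>) y - deriv (f t) y"
      by (intro DERIV_imp_deriv DERIV_diff deriv that)
    then show "\<bar>deriv (f \<tau>) y - deriv (f t) y\<bar> \<le> C * n \<tau> t"
      using C(5)[OF d, of y] by (simp add: n_def)
  qed
  show "continuous_on (time_interval T \<times> UNIV) (\<lambda>(t, x). f t x)"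
    by (rule continuous_on_Times_uniform[OF _ lim bound(1)])
      (use mem in \<open>auto simp: sobolev_cont_def\<close>)
  show "continuous_on (time_interval T \<times> UNIV) (\<lambda>(t, x). deriv (f t) x)"
    by (rule continuous_on_Times_uniform[OF C(3)[OF mem] lim bound(2)])
  assume "T > 0"
  then have 0: "0 \<in> time_interval T" by (simp add: time_interval_def zero_ereal_def)
  from tendstoD[OF lim[OF 0], of 1] obtain d where d: "d > 0"
    "\<forall>\<tau>\<in>time_interval T. \<tau> \<noteq> 0 \<and> dist \<tau> 0 < d \<longrightarrow> dist (n \<tau> 0) 0 < 1"
    unfolding eventually_at by auto
  \<comment> \<open>The first term bounds the initial slice; the additional C pays for a Sobolev
    distance less than 1 from it.\<close>
  define B where "B = C * sobolev_norm s (f 0) + C"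
  have B0: "\<bar>f 0 x\<bar> \<le> B - C" "\<bar>deriv (f 0) x\<bar> \<le> B - C" for x
    using C(4)[OF mem[OF 0], of x] C(5)[OF mem[OF 0], of x] by (simp_all add: B_def)
  have "0 \<le> B - C" using B0(1)[of 0] by linarith
  have "\<bar>f t x\<bar> \<le> B \<and> \<bar>deriv (f t) x\<bar> \<le> B" if t: "t \<in> time_interval T" "t \<le> d / 2" for t x
  proof -
    have "C * n t 0 \<le> C" if "t \<noteq> 0"
      using d(2)[rule_format, OF t(1)] that t \<open>d > 0\<close> C(1)
      by (intro mult_left_le) (auto simp: time_interval_def dist_real_def)
    then have "\<bar>f t x - f 0 x\<bar> \<le> C" "\<bar>deriv (f t) x - deriv (f 0) x\<bar> \<le> C"
      using bound[OF t(1) 0, of x] C(1) by (cases "t = 0"; force)+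
    then show ?thesis using B0[of x] by linarith
  qed
  moreover have "0 < d / 2" "0 \<le> B" using d(1) C(1) \<open>0 \<le> B - C\<close> by auto
  ultimately show "\<exists>\<delta>>0. \<exists>B\<ge>0. \<forall>t\<in>time_interval T. t \<le> \<delta> \<longrightarrow> (\<forall>x. \<bar>f t x\<bar> \<le> B \<and> \<bar>deriv (f t) x\<bar> \<le> B)"
    by blast
qed

section \<open>Slow variation of the logarithmic weight and the final estimate\<close>

lemma log_weight_pos: "\<beta> > 0 \<Longrightarrow> 0 < log_weight \<beta> \<alpha> x"
proof -
  assume "\<beta> > 0"
  then have "1 < exp 1 + \<beta> + \<bar>x\<bar>" using exp_ge_add_one_self[of 1] by linarith
  then show ?thesis by (simp add: log_weight_def)
qed

text \<open>A shift by L multiplies the argument of the logarithm by at most 1 + L, hence adds at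
  most ln(1 + L). The summand e in the weight makes the logarithm at least 1, which turns this
  additive loss into the factor 1 + ln(1 + L).\<close>

lemma log_weight_shift_le:
  assumes "\<beta> > 0" "\<alpha> \<ge> 0" "\<bar>y - x\<bar> \<le> L"
  shows "log_weight \<beta> \<alpha> y \<le> (1 + ln (1 + L)) powr \<alpha> * log_weight \<beta> \<alpha> x"
proof -
  define a where "a = exp 1 + \<beta> + \<bar>x\<bar>"
  define b where "b = exp 1 + \<beta> + \<bar>y\<bar>"
  have "0 \<le> L" using assms(3) by linarith
  have ab: "exp 1 \<le> a" "exp 1 \<le> b" using assms(1) by (auto simp: a_def b_def)
  then have ab1: "1 \<le> a" "1 \<le> b" using exp_ge_add_one_self[of 1] by linarith+
  have ln1: "1 \<le> ln a" "1 \<le> ln b" using ab ab1 by (auto simp: ln_ge_iff)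
  have k: "0 \<le> ln (1 + L)" using \<open>0 \<le> L\<close> by simp
  have "a \<le> b + L" unfolding a_def b_def using assms(3) by linarith
  also have "\<dots> \<le> b + b * L" using mult_right_mono[OF ab1(2) \<open>0 \<le> L\<close>] by simp
  also have "\<dots> = b * (1 + L)" by (simp add: distrib_left)
  finally have "ln a \<le> ln (b * (1 + L))" using ab1 \<open>0 \<le> L\<close> by (subst ln_le_cancel_iff) auto
  also have "\<dots> = ln b + ln (1 + L)" using ab1 \<open>0 \<le> L\<close> by (intro ln_mult_pos) auto
  also have "\<dots> \<le> (1 + ln (1 + L)) * ln b"
    using mult_left_mono[OF ln1(2) k] by (simp add: distrib_right)
  finally have le: "ln a / (1 + ln (1 + L)) \<le> ln b" using k by (simp add: divide_le_eq mult.commute)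
  have "ln b powr (- \<alpha>) \<le> (ln a / (1 + ln (1 + L))) powr (- \<alpha>)"
    using ln1 k assms(2) le by (intro powr_mono2') (auto intro!: divide_pos_pos add_pos_nonneg)
  also have "\<dots> = (1 + ln (1 + L)) powr \<alpha> * ln a powr (- \<alpha>)"
    using ln1 k by (simp add: powr_divide powr_minus field_simps)
  finally show ?thesis by (simp add: log_weight_def a_def b_def)
qed

theorem theorem1p7:
  fixes s \<beta> \<gamma> :: real and T :: ereal
    and \<rho>0 u0 v0 :: "real \<Rightarrow> real" and \<rho> u v :: "real \<Rightarrow> real \<Rightarrow> real"
  assumes "s > 5 / 2"
    and "\<rho>0 \<in> sobolev_cont (s - 1)" and "u0 \<in> sobolev_cont s" and "v0 \<in> sobolev_cont s"
    and "T = lifespan s \<rho>0 u0 v0" and "T > 0"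
    and "solution s T \<rho>0 u0 v0 \<rho> u v"
    and "\<beta> > 0" and "\<beta> / 3 < \<gamma>" and "\<gamma> < \<beta>"
    and "\<rho>0 \<in> o[at_infinity](log_weight \<beta> \<beta>)"
    and "deriv \<rho>0 \<in> O[at_infinity](log_weight \<beta> \<gamma>)"
    and "u0 \<in> O[at_infinity](log_weight \<beta> \<gamma>)"
    and "deriv u0 \<in> O[at_infinity](log_weight \<beta> \<gamma>)"
    and "deriv (deriv u0) \<in> O[at_infinity](log_weight \<beta> \<gamma>)"
    and "v0 \<in> O[at_infinity](log_weight \<beta> \<gamma>)"
    and "deriv v0 \<in> O[at_infinity](log_weight \<beta> \<gamma>)"
    and "deriv (deriv v0) \<in> O[at_infinity](log_weight \<beta> \<gamma>)"
  shows "\<exists>T0>0. ereal T0 < T \<and>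
           uniform_limit {0..T0} (\<lambda>x t. \<bar>\<rho> t x\<bar> / \<bar>log_weight \<beta> \<beta> x\<bar>) (\<lambda>t. 0) at_infinity"
proof -
  define I where "I = time_interval T"
  \<comment> \<open>Here s > 5/2 enters: \<open>\<rho>\<close> has one derivative less than u and v
    and must still be C^1 in x.\<close>
  have "s - 1 > 3 / 2" "s > 3 / 2" using assms(1) by auto
  have curves: "sobolev_curve (s - 1) T \<rho>" "sobolev_curve s T u" "sobolev_curve s T v"
    and init: "\<rho> 0 = \<rho>0"
    and weak: "weak_equation T \<rho> (\<lambda>t x. 1) (\<lambda>t x. \<rho> t x * u t x * v t x) (\<lambda>t x. 0)"
    using assms(7) by (auto simp: solution_def Let_def)
  note \<rho> = sobolev_curve_C1[OF \<open>s - 1 > 3 / 2\<close> curves(1), folded I_def]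
  note u = sobolev_curve_C1[OF \<open>s > 3 / 2\<close> curves(2), folded I_def]
  note v = sobolev_curve_C1[OF \<open>s > 3 / 2\<close> curves(3), folded I_def]
  obtain \<delta>u Bu where Bu: "\<delta>u > 0" "0 \<le> Bu"
    "\<And>t x. t \<in> I \<Longrightarrow> t \<le> \<delta>u \<Longrightarrow> \<bar>u t x\<bar> \<le> Bu \<and> \<bar>deriv (u t) x\<bar> \<le> Bu"
    using u(4)[OF assms(6)] by metis
  obtain \<delta>v Bv where Bv: "\<delta>v > 0" "0 \<le> Bv"
    "\<And>t x. t \<in> I \<Longrightarrow> t \<le> \<delta>v \<Longrightarrow> \<bar>v t x\<bar> \<le> Bv \<and> \<bar>deriv (v t) x\<bar> \<le> Bv"
    using v(4)[OF assms(6)] by metis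
  obtain tb where tb: "0 < tb" "ereal tb < T"
    using ereal_dense2[OF assms(6)] by (auto simp: zero_ereal_def)
  define T0 where "T0 = min tb (min \<delta>u \<delta>v)"
  have T0: "0 < T0" "T0 \<le> tb" "T0 \<le> \<delta>u" "T0 \<le> \<delta>v"
    using tb Bu(1) Bv(1) by (auto simp: T0_def)
  have "ereal T0 \<le> ereal tb" using T0 by simp
  also note tb(2)
  finally have T0T: "ereal T0 < T" .
  have T0_I: "t \<in> I" if "0 \<le> t" "t \<le> T0" for t
  proof -
    have "ereal t \<le> ereal T0" using that by simp
    also note T0T
    finally show ?thesis using that by (simp add: I_def time_interval_def)
  qed
  define c where "c = (\<lambda>t x. u t x * v t x)"
  define cx where "cx = (\<lambda>t x. deriv (u t) x * v t x + u t x * deriv (v t) x)"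
  \<comment> \<open>The x-derivative of the flux, sorted into the part of order zero, with the
    derivative \<open>cx\<close> of the velocity, and the transport part.\<close>
  define h where "h = (\<lambda>t x. cx t x * \<rho> t x + c t x * deriv (\<rho> t) x)"
  have cont_h: "continuous_on (I \<times> UNIV) (\<lambda>(t, x). h t x)"
    using \<rho>(2,3) u(2,3) v(2,3) unfolding h_def cx_def c_def case_prod_beta'
    by (intro continuous_on_add continuous_on_mult)
  have g': "((\<lambda>x. \<rho> t x * u t x * v t x) has_real_derivative h t x) (at x)" if "t \<in> I" for t x
    using DERIV_mult[OF DERIV_mult[OF \<rho>(1)[OF that] u(1)[OF that]] v(1)[OF that], of x]
    by (rule DERIV_cong) (simp add: h_def cx_def c_def algebra_simps)
  have \<rho>_t: "\<rho> t2 y - \<rho> t1 y = - integral {t1..t2} (\<lambda>t. h t y)"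
    if "0 < t1" "t1 \<le> t2" "t2 \<le> T0" for t1 t2 y
  proof (rule weak_conservation_law_pointwise[OF weak \<rho>(2)[unfolded I_def] cont_h[unfolded I_def] _ that(1,2)])
    have "ereal t2 \<le> ereal T0" using that by simp
    also note T0T
    finally show "ereal t2 < T" .
  qed (use g' in \<open>simp add: I_def\<close>)
  \<comment> \<open>The factor 2 accounts for the two products in \<open>cx\<close>; the same M then
    bounds \<open>c\<close>.\<close>
  define M where "M = 2 * (Bu * Bv)"
  have "0 \<le> Bu * Bv" "0 \<le> M" using Bu(2) Bv(2) by (simp_all add: M_def)
  have c_bd: "\<bar>c t y\<bar> \<le> M" and cx_bd: "\<bar>cx t y\<bar> \<le> M" if "0 < t" "t \<le> T0" for t y
  proof -
    have t: "t \<in> I" "t \<le> \<delta>u" "t \<le> \<delta>v" using that T0 T0_I by auto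
    have prod: "\<bar>a * b\<bar> \<le> Bu * Bv" if "\<bar>a\<bar> \<le> Bu" "\<bar>b\<bar> \<le> Bv" for a b
      unfolding abs_mult using that Bu(2) by (intro mult_mono) auto
    note bds = Bu(3)[OF t(1,2), of y] Bv(3)[OF t(1,3), of y]
    have "\<bar>u t y * v t y\<bar> \<le> Bu * Bv" "\<bar>deriv (u t) y * v t y\<bar> \<le> Bu * Bv" "\<bar>u t y * deriv (v t) y\<bar> \<le> Bu * Bv"
      using bds by (auto intro!: prod)
    then show "\<bar>c t y\<bar> \<le> M" "\<bar>cx t y\<bar> \<le> M"
      using \<open>0 \<le> Bu * Bv\<close> unfolding c_def cx_def M_def by linarith+
  qed
  have sub: "{0..T0} \<times> UNIV \<subseteq> I \<times> (UNIV :: real set)" using T0_I by auto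
  have \<rho>_bound: "\<bar>\<rho> t x\<bar> \<le> exp ((M + 1) * t) * B"
    if "0 \<le> t" "t \<le> T0" "\<And>y. \<bar>y - x\<bar> \<le> M * t \<Longrightarrow> \<bar>\<rho> 0 y\<bar> \<le> B" for t x B
    by (rule continuity_equation_bound[OF continuous_on_subset[OF \<rho>(2) sub] continuous_on_subset[OF cont_h sub]
        \<rho>(1)[OF T0_I] _ c_bd cx_bd \<rho>_t that \<open>0 \<le> M\<close>]) (auto simp: h_def)
  have "uniform_limit {0..T0} (\<lambda>x t. \<bar>\<rho> t x\<bar> / \<bar>log_weight \<beta> \<beta> x\<bar>) (\<lambda>t. 0) at_infinity"
  proof (rule uniform_limitI)
    fix e :: real assume "e > 0"
    \<comment> \<open>\<open>k\<close> is the loss of the weight over the distance M T0 and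
      \<open>E\<close> the growth factor in time; \<eta> is tuned to E \<eta> k = e / 2, where the
      half yields the strict inequality.\<close>
    define k where "k = (1 + ln (1 + M * T0)) powr \<beta>"
    define E where "E = exp ((M + 1) * T0)"
    have "0 \<le> M * T0" using \<open>0 \<le> M\<close> T0 by simp
    then have "0 < 1 + ln (1 + M * T0)" by (intro add_pos_nonneg) auto
    then have k: "0 < k" by (simp add: k_def)
    have E: "0 < E" by (simp add: E_def)
    define \<eta> where "\<eta> = e / (2 * E * k)"
    have \<eta>: "\<eta> > 0" "E * (\<eta> * k) = e / 2" using \<open>e > 0\<close> k E by (auto simp: \<eta>_def)
    have "\<forall>\<^sub>F y in at_infinity. norm (\<rho>0 y) \<le> \<eta> * norm (log_weight \<beta> \<beta> y)"
      by (rule landau_o.smallD[OF assms(11) \<eta>(1)])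
    then obtain b where "\<forall>y. b \<le> norm y \<longrightarrow> norm (\<rho>0 y) \<le> \<eta> * norm (log_weight \<beta> \<beta> y)"
      unfolding eventually_at_infinity by blast
    then have b: "\<bar>\<rho>0 y\<bar> \<le> \<eta> * log_weight \<beta> \<beta> y" if "b \<le> \<bar>y\<bar>" for y
      using that unfolding real_norm_def abs_of_pos[OF log_weight_pos[OF assms(8)]] by blast
    show "\<forall>\<^sub>F x in at_infinity. \<forall>t\<in>{0..T0}. dist (\<bar>\<rho> t x\<bar> / \<bar>log_weight \<beta> \<beta> x\<bar>) 0 < e"
      unfolding eventually_at_infinity
    \<comment> \<open>The values of \<open>\<rho>0\<close> that influence (t, x) lie within M T0 of
      x, so this threshold keeps them all beyond b, for every t in [0, T0] at once.\<close>
    proof (intro exI[of _ "b + M * T0"] allI impI ballI)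
      fix x t :: real assume x: "b + M * T0 \<le> norm x" and t: "t \<in> {0..T0}"
      define w where "w = log_weight \<beta> \<beta> x"
      have w: "0 < w" unfolding w_def by (rule log_weight_pos[OF assms(8)])
      have "\<bar>\<rho> t x\<bar> \<le> exp ((M + 1) * t) * (\<eta> * (k * w))"
      proof (rule \<rho>_bound)
        fix y assume "\<bar>y - x\<bar> \<le> M * t"
        also have "\<dots> \<le> M * T0" using t \<open>0 \<le> M\<close> by (intro mult_left_mono) auto
        finally have y: "\<bar>y - x\<bar> \<le> M * T0" .
        then have "b \<le> \<bar>y\<bar>" using x unfolding real_norm_def by linarith
        from b[OF this] have "\<bar>\<rho>0 y\<bar> \<le> \<eta> * log_weight \<beta> \<beta> y" .
        also have "\<dots> \<le> \<eta> * (k * w)"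
          unfolding k_def w_def using \<eta>(1) assms(8) y by (intro mult_left_mono log_weight_shift_le) auto
        finally show "\<bar>\<rho> 0 y\<bar> \<le> \<eta> * (k * w)" by (simp add: init)
      qed (use t in auto)
      also have "\<dots> \<le> E * (\<eta> * (k * w))"
        unfolding E_def using t \<open>0 \<le> M\<close> \<eta>(1) k w
        by (intro mult_right_mono) (auto intro!: mult_left_mono)
      also have "\<dots> = e / 2 * w"
        unfolding \<eta>(2)[symmetric] by (simp only: mult.assoc)
      finally have "\<bar>\<rho> t x\<bar> / \<bar>w\<bar> \<le> e / 2" using w by (simp add: divide_le_eq)
      moreover have "0 \<le> \<bar>\<rho> t x\<bar> / \<bar>w\<bar>" by simp
      ultimately show "dist (\<bar>\<rho> t x\<bar> / \<bar>log_weight \<beta> \<beta> x\<bar>) 0 < e"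
        using \<open>e > 0\<close> unfolding w_def[symmetric] dist_real_def by linarith
    qed
  qed
  then show ?thesis using T0(1) T0T by blast
qed

end
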